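(* Let $\mathcal{S}$ be a compact convex subset of a Euclidean space with $3$-dimensional affine hull, $\mathrm{Aff}(\mathcal{S}) = \mathbb{R}^3$. Then the group of bijective affine transformations of $\mathcal{S}$ (onto itself) acts transitively on the set $\mathcal{S}_{\mathrm{ext}}$ of extreme points of $\mathcal{S}$ if and only if $\mathcal{S}$ is affine isomorphic to one of the following three kinds of objects: (1) a $3$-dimensional symmetric (i.e. vertex-transitive) convex polytope; (2) the $3$-dimensional circular cylinder $\{(x,y,z) \in \mathbb{R}^3 \mid x^2 + y^2 \leq 1,\ 0 \leq z \leq 1\}$; (3) the $3$-dimensional unit ball.
   Context: A group $G$ acts transitively on a set $X$ if for any $x_1,x_2\in X$ there is $g\in G$ with $g\cdot x_1=x_2$. A convex polytope is called symmetric, or vertex-transitive, if the group of affine isometries mapping it onto itself acts transitively on its set of vertices. Two convex sets are affine isomorphic if there is an affine bijection between them. The unit ball is the closed solid ball. *)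

theory Defs
  imports "HOL-Analysis.Analysis" "HOL-Algebra.Group_Action"
begin

section \<open>Affine maps between convex sets\<close>

definition affine_map_on :: "'a::real_vector set \<Rightarrow> ('a \<Rightarrow> 'b::real_vector) \<Rightarrow> bool" where
  "affine_map_on S f \<longleftrightarrow>
     (\<forall>x\<in>S. \<forall>y\<in>S. \<forall>u\<ge>0. \<forall>v\<ge>0. u + v = 1 \<longrightarrow>
        f (u *\<^sub>R x + v *\<^sub>R y) = u *\<^sub>R f x + v *\<^sub>R f y)"

definition affine_isomorphic :: "'a::real_vector set \<Rightarrow> 'b::real_vector set \<Rightarrow> bool" where
  "affine_isomorphic S T \<longleftrightarrow> (\<exists>f. bij_betw f S T \<and> affine_map_on S f)"

text \<open>On the whole space, preserving convex combinations already gives the usual notion of an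
  affine map, i.e. a linear map followed by a translation.\<close>

lemma affine_map_on_UNIV_iff:
  fixes f :: "'a::real_vector \<Rightarrow> 'b::real_vector"
  shows "affine_map_on UNIV f \<longleftrightarrow> linear (\<lambda>x. f x - f 0)"
proof
  assume "linear (\<lambda>x. f x - f 0)"
  then interpret linear "\<lambda>x. f x - f 0" .
  show "affine_map_on UNIV f"
    unfolding affine_map_on_def
  proof (intro ballI allI impI)
    fix x y :: 'a and u v :: real
    assume "u + v = 1"
    have "f (u *\<^sub>R x + v *\<^sub>R y) - f 0 = u *\<^sub>R (f x - f 0) + v *\<^sub>R (f y - f 0)"
      by (simp only: add scale)
    also have "\<dots> = u *\<^sub>R f x + v *\<^sub>R f y - (u + v) *\<^sub>R f 0"
      by (simp add: algebra_simps)
    finally show "f (u *\<^sub>R x + v *\<^sub>R y) = u *\<^sub>R f x + v *\<^sub>R f y"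
      using \<open>u + v = 1\<close> by simp
  qed
next
  assume aff: "affine_map_on UNIV f"
  define g where "g x = f x - f 0" for x
  have conv: "f (u *\<^sub>R x + v *\<^sub>R y) = u *\<^sub>R f x + v *\<^sub>R f y"
    if "0 \<le> u" "0 \<le> v" "u + v = 1" for x y u v
    using aff that unfolding affine_map_on_def by blast
  have sc01: "g (u *\<^sub>R x) = u *\<^sub>R g x" if "0 \<le> u" "u \<le> 1" for u x
    using conv[of u "1 - u" x 0] that by (simp add: g_def algebra_simps)
  have scp: "g (u *\<^sub>R x) = u *\<^sub>R g x" if "0 \<le> u" for u x
  proof (cases "u \<le> 1")
    case False
    have "g (inverse u *\<^sub>R (u *\<^sub>R x)) = inverse u *\<^sub>R g (u *\<^sub>R x)"
      using False by (intro sc01) (auto simp: field_simps)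
    then have "u *\<^sub>R g x = u *\<^sub>R (inverse u *\<^sub>R g (u *\<^sub>R x))"
      using False by simp
    then show ?thesis using False by simp
  qed (use sc01 that in auto)
  have half: "g ((1/2) *\<^sub>R x + (1/2) *\<^sub>R y) = (1/2) *\<^sub>R (g x + g y)" for x y
  proof -
    have "(1/2) *\<^sub>R f 0 + (1/2) *\<^sub>R f 0 = f 0"
      by (simp flip: scaleR_left_distrib)
    then show ?thesis
      using conv[of "1/2" "1/2" x y] by (simp add: g_def algebra_simps)
  qed
  have add: "g (x + y) = g x + g y" for x y
  proof -
    have "g (x + y) = g (2 *\<^sub>R ((1/2) *\<^sub>R x + (1/2) *\<^sub>R y))"
      by (simp add: scaleR_right_distrib)
    also have "\<dots> = 2 *\<^sub>R ((1/2) *\<^sub>R (g x + g y))"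
      by (simp only: scp half)
    finally show ?thesis by simp
  qed
  have "g x + g (- x) = 0" for x
    using add[of x "- x"] by (simp add: g_def)
  then have neg: "g (- x) = - g x" for x
    by (metis add.inverse_unique)
  have "g (u *\<^sub>R x) = u *\<^sub>R g x" for u x
  proof (cases "0 \<le> u")
    case False
    then show ?thesis using scp[of "- u" x] neg[of "u *\<^sub>R x"] by simp
  qed (rule scp)
  with add have "linear g" by (intro linearI) auto
  then show "linear (\<lambda>x. f x - f 0)" by (simp add: g_def[abs_def])
qed


section \<open>Transformation groups\<close>

definition affine_automorphism_group :: "'a::real_vector set \<Rightarrow> ('a \<Rightarrow> 'a) monoid" where
  "affine_automorphism_group S = BijGroup S\<lparr>carrier := {f \<in> Bij S. affine_map_on S f}\<rparr>"

definition affine_isometry_group :: "'a::real_normed_vector set \<Rightarrow> ('a \<Rightarrow> 'a) monoid" where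
  "affine_isometry_group P = BijGroup UNIV\<lparr>carrier :=
     {f \<in> Bij UNIV. affine_map_on UNIV f \<and> (\<forall>x y. dist (f x) (f y) = dist x y) \<and> f ` P = P}\<rparr>"

text \<open>For a group of transformations of a superset of \<open>X\<close> that map \<open>X\<close> onto itself.\<close>

definition acts_transitively_on :: "('a \<Rightarrow> 'a) monoid \<Rightarrow> 'a set \<Rightarrow> bool" where
  "acts_transitively_on G X \<longleftrightarrow> transitive_action G X (\<lambda>g. restrict g X)"

definition vertex_transitive :: "'a::euclidean_space set \<Rightarrow> bool" where
  "vertex_transitive P \<longleftrightarrow> acts_transitively_on (affine_isometry_group P) {v. v extreme_point_of P}"

text \<open>The two groups are groups, and they do act on the extreme points, so that in both cases
  transitivity amounts to its elementwise formulation.\<close>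

lemma BijGroup_sub_group:
  assumes "H \<subseteq> Bij A" "(\<lambda>x\<in>A. x) \<in> H"
    and "\<And>f g. f \<in> H \<Longrightarrow> g \<in> H \<Longrightarrow> compose A f g \<in> H"
    and "\<And>f. f \<in> H \<Longrightarrow> restrict (inv_into A f) A \<in> H"
  shows "group (BijGroup A\<lparr>carrier := H\<rparr>)"
proof -
  interpret group "BijGroup A" by (rule group_BijGroup)
  have "subgroup H (BijGroup A)"
  proof (rule subgroupI)
    fix f g assume "f \<in> H" "g \<in> H"
    then show "f \<otimes>\<^bsub>BijGroup A\<^esub> g \<in> H"
      using assms(1,3) by (auto simp: BijGroup_def)
  next
    fix f assume "f \<in> H"
    then show "inv\<^bsub>BijGroup A\<^esub> f \<in> H"
      using assms(1,4) by (auto simp: inv_BijGroup)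
  qed (use assms in \<open>auto simp: BijGroup_def\<close>)
  then show ?thesis by (rule subgroup_imp_group)
qed

lemma acts_transitively_on_iff:
  assumes "group (BijGroup A\<lparr>carrier := H\<rparr>)" "H \<subseteq> Bij A" "X \<subseteq> A"
    and X: "\<And>f. f \<in> H \<Longrightarrow> f ` X = X"
  shows "acts_transitively_on (BijGroup A\<lparr>carrier := H\<rparr>) X \<longleftrightarrow>
           (\<forall>x\<in>X. \<forall>y\<in>X. \<exists>f\<in>H. f x = y)"
proof -
  have bij: "restrict f X \<in> Bij X" if "f \<in> H" for f
  proof -
    have "inj_on f X"
      using that assms(2,3) by (auto simp: Bij_def bij_betw_def intro: inj_on_subset)
    then show ?thesis using X[OF that] by (simp add: Bij_def bij_betw_def)
  qed
  have "group_hom (BijGroup A\<lparr>carrier := H\<rparr>) (BijGroup X) (\<lambda>f. restrict f X)"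
  proof (intro group_hom.intro group_hom_axioms.intro assms(1) group_BijGroup homI)
    fix f g
    assume "f \<in> carrier (BijGroup A\<lparr>carrier := H\<rparr>)" "g \<in> carrier (BijGroup A\<lparr>carrier := H\<rparr>)"
    then have "f \<in> H" "g \<in> H" by auto
    then have "restrict (compose A f g) X = compose X (restrict f X) (restrict g X)"
      using X[of g] assms(3) by (auto simp: compose_def restrict_def fun_eq_iff)
    then show "restrict (f \<otimes>\<^bsub>BijGroup A\<lparr>carrier := H\<rparr>\<^esub> g) X =
                 restrict f X \<otimes>\<^bsub>BijGroup X\<^esub> restrict g X"
      using \<open>f \<in> H\<close> \<open>g \<in> H\<close> bij assms(2) by (auto simp: BijGroup_def)
  qed (use bij in \<open>auto simp: BijGroup_def\<close>)
  then show ?thesis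
    unfolding acts_transitively_on_def transitive_action_def transitive_action_axioms_def
      group_action_def by auto
qed

lemma affine_map_on_compose:
  assumes "affine_map_on A f" "affine_map_on A g" "g ` A \<subseteq> A" "convex A"
  shows "affine_map_on A (compose A f g)"
  using assms unfolding affine_map_on_def by (auto simp: compose_def convex_def image_subset_iff)

lemma affine_map_on_inv_into:
  assumes "affine_map_on A f" "bij_betw f A A" "convex A"
  shows "affine_map_on A (restrict (inv_into A f) A)"
  unfolding affine_map_on_def
proof (intro ballI allI impI)
  fix x y :: 'a and u v :: real
  assume xy: "x \<in> A" "y \<in> A" and uv: "0 \<le> u" "0 \<le> v" "u + v = 1"
  let ?g = "inv_into A f"
  have g: "?g x \<in> A" "?g y \<in> A" "f (?g x) = x" "f (?g y) = y"
    using xy assms(2) by (auto simp: bij_betw_def inv_into_into f_inv_into_f)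
  have "f (u *\<^sub>R ?g x + v *\<^sub>R ?g y) = u *\<^sub>R x + v *\<^sub>R y"
    using assms(1) g uv unfolding affine_map_on_def by metis
  moreover have "u *\<^sub>R ?g x + v *\<^sub>R ?g y \<in> A" "u *\<^sub>R x + v *\<^sub>R y \<in> A"
    using assms(3) g xy uv by (auto simp: convex_def)
  ultimately show "restrict ?g A (u *\<^sub>R x + v *\<^sub>R y) =
      u *\<^sub>R restrict ?g A x + v *\<^sub>R restrict ?g A y"
    using xy assms(2) by (simp add: bij_betw_def) (metis inv_into_f_f)
qed

lemma extreme_point_of_affine_image:
  assumes "affine_map_on A f" "inj_on f A" "S \<subseteq> A" "convex S" "x extreme_point_of S"
  shows "f x extreme_point_of (f ` S)"
  unfolding extreme_point_of_def
proof (intro conjI ballI notI)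
  show "f x \<in> f ` S" using assms(5) by (auto simp: extreme_point_of_def)
  fix a b assume "a \<in> f ` S" "b \<in> f ` S" and seg: "f x \<in> open_segment a b"
  then obtain p q where pq: "p \<in> S" "q \<in> S" "a = f p" "b = f q" by auto
  from seg obtain u where u: "0 < u" "u < 1" "a \<noteq> b" "f x = (1 - u) *\<^sub>R a + u *\<^sub>R b"
    by (auto simp: in_segment)
  let ?z = "(1 - u) *\<^sub>R p + u *\<^sub>R q"
  have "f ?z = (1 - u) *\<^sub>R f p + u *\<^sub>R f q"
  proof -
    have "p \<in> A" "q \<in> A" "0 \<le> 1 - u" "0 \<le> u" "1 - u + u = 1" using pq u assms(3) by auto
    then show ?thesis using assms(1) unfolding affine_map_on_def by blast
  qed
  then have "f ?z = f x" using u pq by simp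
  moreover have "?z \<in> S" using pq u assms(4) by (auto simp: convex_def)
  moreover have "x \<in> S" using assms(5) by (auto simp: extreme_point_of_def)
  ultimately have "x = ?z" using assms(2,3) by (metis inj_onD subsetD)
  then have "x \<in> open_segment p q" using u pq by (auto simp: in_segment)
  then show False using assms(5) pq by (auto simp: extreme_point_of_def)
qed

lemma extreme_points_affine_image:
  assumes "affine_map_on A f" "bij_betw f A A" "convex A" "S \<subseteq> A" "convex S" "f ` S = S"
  shows "f ` {x. x extreme_point_of S} = {x. x extreme_point_of S}"
proof
  have inj: "inj_on f A" using assms(2) by (simp add: bij_betw_def)
  show "f ` {x. x extreme_point_of S} \<subseteq> {x. x extreme_point_of S}"
    using extreme_point_of_affine_image[OF assms(1) inj assms(4,5)] assms(6) by auto
  show "{x. x extreme_point_of S} \<subseteq> f ` {x. x extreme_point_of S}"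
  proof
    fix y assume "y \<in> {x. x extreme_point_of S}"
    then have y: "y extreme_point_of S" by simp
    let ?g = "restrict (inv_into A f) A"
    have g: "?g (f x) = x" if "x \<in> S" for x
      using that assms(4,6) inj by (auto simp: inv_into_f_f)
    have "?g ` S = (\<lambda>x. ?g (f x)) ` S"
      using assms(6) by (metis image_image)
    also have "\<dots> = S"
      using g by (simp only: image_cong[OF refl g] image_ident)
    finally have "?g ` S = S" .
    moreover have "inj_on ?g A"
      using bij_betw_inv_into[OF assms(2)] by (simp add: bij_betw_def)
    ultimately have "?g y extreme_point_of S"
      using extreme_point_of_affine_image[OF affine_map_on_inv_into[OF assms(1-3)] _ assms(4,5) y]
      by simp
    moreover have "f (?g y) = y"
      using y assms(2,4) by (auto simp: extreme_point_of_def bij_betw_def f_inv_into_f)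
    ultimately show "y \<in> f ` {x. x extreme_point_of S}" by force
  qed
qed

lemma group_affine_automorphism_group:
  assumes "convex S"
  shows "group (affine_automorphism_group S)"
  unfolding affine_automorphism_group_def
proof (rule BijGroup_sub_group, goal_cases)
  case 2
  show ?case using assms by (auto simp: id_Bij affine_map_on_def convex_def)
next
  case (3 f g)
  then have "affine_map_on S f" "affine_map_on S g" "g ` S \<subseteq> S"
    by (auto simp: Bij_def bij_betw_def)
  then have "affine_map_on S (compose S f g)"
    using assms by (rule affine_map_on_compose)
  with 3 show ?case by (simp add: compose_Bij)
next
  case (4 f)
  then have "affine_map_on S (restrict (inv_into S f) S)"
    using assms by (intro affine_map_on_inv_into) (auto simp: Bij_def)
  with 4 show ?case by (simp add: restrict_inv_into_Bij)
qed auto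

lemma affine_automorphisms_transitive_iff:
  assumes "convex S"
  shows "acts_transitively_on (affine_automorphism_group S) {x. x extreme_point_of S} \<longleftrightarrow>
    (\<forall>x y. x extreme_point_of S \<longrightarrow> y extreme_point_of S \<longrightarrow>
       (\<exists>f. bij_betw f S S \<and> affine_map_on S f \<and> f x = y))"
proof -
  have "acts_transitively_on (affine_automorphism_group S) {x. x extreme_point_of S} \<longleftrightarrow>
    (\<forall>x\<in>{x. x extreme_point_of S}. \<forall>y\<in>{x. x extreme_point_of S}.
       \<exists>f\<in>{f \<in> Bij S. affine_map_on S f}. f x = y)"
    unfolding affine_automorphism_group_def
  proof (rule acts_transitively_on_iff)
    fix f assume "f \<in> {f \<in> Bij S. affine_map_on S f}"
    then show "f ` {x. x extreme_point_of S} = {x. x extreme_point_of S}"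
      using assms by (intro extreme_points_affine_image[of S]) (auto simp: Bij_def bij_betw_def)
  qed (use group_affine_automorphism_group[OF assms] in
        \<open>auto simp: affine_automorphism_group_def extreme_point_of_def\<close>)
  moreover have "(\<exists>f\<in>{f \<in> Bij S. affine_map_on S f}. f x = y) \<longleftrightarrow>
      (\<exists>f. bij_betw f S S \<and> affine_map_on S f \<and> f x = y)" if "x \<in> S" for x y
  proof
    assume "\<exists>f. bij_betw f S S \<and> affine_map_on S f \<and> f x = y"
    then obtain f where f: "bij_betw f S S" "affine_map_on S f" "f x = y" by auto
    have "restrict f S \<in> Bij S" using f(1) by (simp add: Bij_def)
    moreover have "affine_map_on S (restrict f S)"
      using f(2) assms by (auto simp: affine_map_on_def convex_def)
    ultimately show "\<exists>f\<in>{f \<in> Bij S. affine_map_on S f}. f x = y"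
      using f(3) that by (intro bexI[of _ "restrict f S"]) auto
  qed (auto simp: Bij_def)
  ultimately show ?thesis by (auto simp: extreme_point_of_def)
qed

lemma group_affine_isometry_group:
  fixes P :: "'a::real_normed_vector set"
  shows "group (affine_isometry_group P)"
  unfolding affine_isometry_group_def
proof (rule BijGroup_sub_group, goal_cases)
  case 2
  show ?case using id_Bij[of "UNIV :: 'a set"] by (auto simp: affine_map_on_def)
next
  case (3 f g)
  then have fg: "affine_map_on UNIV f" "affine_map_on UNIV g" "g ` UNIV \<subseteq> UNIV"
    "f ` P = P" "g ` P = P"
    by auto
  have "affine_map_on UNIV (compose UNIV f g)"
    using fg(1-3) convex_UNIV by (rule affine_map_on_compose)
  moreover have "compose UNIV f g ` P = f ` g ` P"
    by (simp add: compose_def image_image)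
  moreover have "dist (compose UNIV f g x) (compose UNIV f g y) = dist x y" for x y
    using 3 by (simp add: compose_def)
  ultimately show ?case
    using 3 fg by (simp add: compose_Bij)
next
  case (4 f)
  then have f: "bij f" "affine_map_on UNIV f" "\<And>x y. dist (f x) (f y) = dist x y" "f ` P = P"
    by (auto simp: Bij_def)
  have "inv_into UNIV f ` P = P"
    using f(1,4) by (metis bij_betw_imp_inj_on image_inv_f_f)
  moreover have "dist (inv_into UNIV f x) (inv_into UNIV f y) = dist x y" for x y
    using f(1) f(3)[of "inv_into UNIV f x" "inv_into UNIV f y"]
    by (simp add: bij_is_surj surj_f_inv_f)
  ultimately show ?case
    using f(1,2) 4 affine_map_on_inv_into[of UNIV f] restrict_inv_into_Bij[of f UNIV] by simp
qed auto

lemma vertex_transitive_iff: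
  fixes P :: "'a::euclidean_space set"
  assumes "convex P"
  shows "vertex_transitive P \<longleftrightarrow>
    (\<forall>v w. v extreme_point_of P \<longrightarrow> w extreme_point_of P \<longrightarrow>
       (\<exists>f. bij f \<and> affine_map_on UNIV f \<and> (\<forall>x y. dist (f x) (f y) = dist x y) \<and>
            f ` P = P \<and> f v = w))"
proof -
  let ?H = "{f \<in> Bij UNIV. affine_map_on UNIV f \<and> (\<forall>x y. dist (f x) (f y) = dist x y) \<and> f ` P = P}"
  have "vertex_transitive P \<longleftrightarrow>
    (\<forall>x\<in>{x. x extreme_point_of P}. \<forall>y\<in>{x. x extreme_point_of P}. \<exists>f\<in>?H. f x = y)"
    unfolding vertex_transitive_def affine_isometry_group_def
  proof (rule acts_transitively_on_iff)
    fix f assume "f \<in> ?H"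
    then show "f ` {x. x extreme_point_of P} = {x. x extreme_point_of P}"
      using assms by (intro extreme_points_affine_image[of UNIV]) (auto simp: Bij_def)
  qed (use group_affine_isometry_group[of P] in \<open>auto simp: affine_isometry_group_def\<close>)
  then show ?thesis by (auto simp: Bij_def Bex_def)
qed

end

theory Submission
  imports Defs
begin

text \<open>An affine automorphism of a convex body fixes its centroid and, having determinant
  of modulus one, preserves its covariance form; so after an affine change of coordinates the
  automorphisms are orthogonal. The extreme points then form an orbit of the group \<open>G\<close> of orthogonal
  symmetries. If the orbit is finite, the body is a symmetric polytope by Krein--Milman. If it is
  infinite, \<open>G\<close> contains rotations by arbitrarily small nonzero angles; their powers accumulate
  at all rotations about some axis, which therefore belong to \<open>G\<close>. Either every element of \<open>G\<close>
  preserves that axis, and the orbit consists of two parallel circles of equal radius, or \<open>G\<close>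
  contains all rotations about two different axes, and the orbit is a sphere.\<close>

section \<open>Affine isomorphisms\<close>

text \<open>An element of the automorphism group is merely a function on \<open>S\<close> that
  respects convex combinations, and \<open>S\<close> may lie flat in a larger space. Around an
  interior point such a function is forced to have the form \<open>L x + b\<close>, so the work is
  done on a copy of \<open>S\<close> with interior in \<open>real^3\<close>; there change of
  variables applies. No topology is put on the group of symmetries. Limits of symmetries are taken
  pointwise and closedness of \<open>S\<close> keeps the limit points in \<open>S\<close>; a limit
  rotation is onto because the rotation by the opposite angle maps \<open>S\<close> into itself as
  well. Orientation-reversing symmetries are avoided by squaring. For two axes, factoring a rotation
  into rotations about them would need more and more factors as the axes get closer. An extremal
  argument replaces this: the highest point of a compact subset of the sphere invariant under both
  families can only be the pole.\<close>

lemma affine_map_onD: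
  "\<lbrakk>affine_map_on S f; x \<in> S; y \<in> S; 0 \<le> u; 0 \<le> v; u + v = 1\<rbrakk> \<Longrightarrow>
    f (u *\<^sub>R x + v *\<^sub>R y) = u *\<^sub>R f x + v *\<^sub>R f y"
  by (auto simp: affine_map_on_def)

lemma affine_map_on_linear_translation:
  assumes "linear L"
  shows "affine_map_on S (\<lambda>x. L x + b)"
  unfolding affine_map_on_def
proof (intro ballI allI impI)
  fix x y and u v :: real
  assume uv: "u + v = 1"
  have "L (u *\<^sub>R x + v *\<^sub>R y) + b = u *\<^sub>R L x + v *\<^sub>R L y + (u + v) *\<^sub>R b"
    using uv by (simp add: linear_add[OF assms] linear_cmul[OF assms])
  then show "L (u *\<^sub>R x + v *\<^sub>R y) + b = u *\<^sub>R (L x + b) + v *\<^sub>R (L y + b)"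
    by (simp add: algebra_simps)
qed

lemma affine_map_on_comp:
  assumes "affine_map_on S f" "affine_map_on T g" "f ` S \<subseteq> T"
  shows "affine_map_on S (g \<circ> f)"
  using assms unfolding affine_map_on_def by (auto simp: image_subset_iff)

lemma affine_map_on_inverse:
  assumes "affine_map_on S f" "bij_betw f S T" "convex S"
  shows "affine_map_on T (inv_into S f)"
  unfolding affine_map_on_def
proof (intro ballI allI impI)
  fix x y and u v :: real
  assume xy: "x \<in> T" "y \<in> T" and uv: "0 \<le> u" "0 \<le> v" "u + v = 1"
  let ?g = "inv_into S f"
  have g: "?g x \<in> S" "?g y \<in> S" "f (?g x) = x" "f (?g y) = y"
    using xy assms(2) by (auto simp: bij_betw_def inv_into_into f_inv_into_f)
  have "f (u *\<^sub>R ?g x + v *\<^sub>R ?g y) = u *\<^sub>R x + v *\<^sub>R y"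
    using affine_map_onD[OF assms(1) g(1,2) uv] g by simp
  moreover have "u *\<^sub>R ?g x + v *\<^sub>R ?g y \<in> S"
    using assms(3) g uv by (auto simp: convex_def)
  ultimately show "?g (u *\<^sub>R x + v *\<^sub>R y) = u *\<^sub>R ?g x + v *\<^sub>R ?g y"
    using assms(2) by (metis bij_betw_imp_inj_on inv_into_f_f)
qed

lemma affine_isomorphic_trans:
  assumes "affine_isomorphic S T" "affine_isomorphic T U"
  shows "affine_isomorphic S U"
proof -
  obtain f g where fg: "bij_betw f S T" "affine_map_on S f" "bij_betw g T U" "affine_map_on T g"
    using assms by (auto simp: affine_isomorphic_def)
  then have "affine_map_on S (g \<circ> f)" by (intro affine_map_on_comp) (auto simp: bij_betw_def)
  then show ?thesis using fg bij_betw_trans unfolding affine_isomorphic_def by blast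
qed

lemma affine_isomorphic_sym:
  assumes "affine_isomorphic S T" "convex S"
  shows "affine_isomorphic T S"
  using assms affine_map_on_inverse bij_betw_inv_into unfolding affine_isomorphic_def by blast

lemma affine_isomorphic_linear_image:
  assumes "linear L" "inj_on L S"
  shows "affine_isomorphic S ((\<lambda>x. L x + b) ` S)"
proof -
  have "bij_betw (\<lambda>x. L x + b) S ((\<lambda>x. L x + b) ` S)"
    using assms(2) by (simp add: bij_betw_def inj_on_def)
  then show ?thesis
    using affine_map_on_linear_translation[OF assms(1)] unfolding affine_isomorphic_def by blast
qed

text \<open>Transitivity without the group records, equivalent for convex \<open>S\<close> by
  \<open>affine_automorphisms_transitive_iff\<close>; in this form it can be carried along affine
  isomorphisms.\<close>

definition affinely_transitive :: "'a::real_vector set \<Rightarrow> bool" where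
  "affinely_transitive S \<longleftrightarrow> (\<forall>x y. x extreme_point_of S \<longrightarrow> y extreme_point_of S \<longrightarrow>
     (\<exists>f. bij_betw f S S \<and> affine_map_on S f \<and> f x = y))"

text \<open>Conjugation: the isomorphism carries extreme points to extreme points, and an
  automorphism of \<open>T\<close> pulled back through it is one of \<open>S\<close>.\<close>

lemma affinely_transitive_isomorphic:
  assumes iso: "affine_isomorphic S T" and "convex S" "affinely_transitive T"
  shows "affinely_transitive S"
  unfolding affinely_transitive_def
proof (intro allI impI)
  fix x y assume xy: "x extreme_point_of S" "y extreme_point_of S"
  obtain f where f: "bij_betw f S T" "affine_map_on S f"
    using iso by (auto simp: affine_isomorphic_def)
  have "f x extreme_point_of T" "f y extreme_point_of T"
    using extreme_point_of_affine_image[OF f(2) _ subset_refl assms(2)] xy f(1)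
    by (auto simp: bij_betw_def)
  then obtain g where g: "bij_betw g T T" "affine_map_on T g" "g (f x) = f y"
    using assms(3) by (auto simp: affinely_transitive_def)
  let ?h = "inv_into S f \<circ> (g \<circ> f)"
  have "bij_betw ?h S S"
    using f(1) g(1) by (intro bij_betw_trans bij_betw_inv_into)
  moreover have "affine_map_on S ?h"
    using f g affine_map_on_inverse[OF f(2,1) assms(2)]
    by (intro affine_map_on_comp) (auto simp: bij_betw_def)
  moreover have "?h x = y"
    using f(1) g(3) xy(2) by (simp add: bij_betw_def extreme_point_of_def)
  ultimately show "\<exists>h. bij_betw h S S \<and> affine_map_on S h \<and> h x = y" by blast
qed

lemma affinely_transitive_vertex_transitive:
  fixes P :: "'a::euclidean_space set"
  assumes "convex P" "vertex_transitive P"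
  shows "affinely_transitive P"
  unfolding affinely_transitive_def
proof (intro allI impI)
  fix x y assume "x extreme_point_of P" "y extreme_point_of P"
  then obtain f where f: "bij f" "affine_map_on UNIV f" "f ` P = P" "f x = y"
    using assms(2) unfolding vertex_transitive_iff[OF assms(1)] by blast
  then have "bij_betw f P P" "affine_map_on P f"
    by (auto simp: bij_betw_def affine_map_on_def intro: inj_on_subset)
  then show "\<exists>f. bij_betw f P P \<and> affine_map_on P f \<and> f x = y" using f by blast
qed

section \<open>Affine maps on bodies with interior\<close>

text \<open>With \<open>p\<close> as origin, every direction has short multiples that stay in
  \<open>S\<close>, so rescaling defines \<open>L\<close> everywhere. Since \<open>S\<close> is
  closed under shrinking towards \<open>p\<close>, the values of \<open>f\<close> far from
  \<open>p\<close> are determined by those near \<open>p\<close>.\<close>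

lemma affine_map_on_extend:
  fixes f :: "'a::euclidean_space \<Rightarrow> 'b::real_vector"
  assumes f: "affine_map_on S f" and p: "p \<in> interior S"
  obtains L b where "linear L" "\<And>x. x \<in> S \<Longrightarrow> f x = L x + b"
proof -
  obtain e where e: "0 < e" "ball p e \<subseteq> S" using p by (auto simp: mem_interior)
  define g where "g x = f (p + x) - f p" for x
  have pS: "p \<in> S" using p interior_subset by blast
  have near: "p + x \<in> S" if "norm x < e" for x
    using e that by (auto intro!: subsetD[OF e(2)] simp: dist_norm)
  have conv: "g (u *\<^sub>R x + v *\<^sub>R y) = u *\<^sub>R g x + v *\<^sub>R g y"
    if "p + x \<in> S" "p + y \<in> S" "0 \<le> u" "0 \<le> v" "u + v = 1" for x y u v
  proof -
    have "u *\<^sub>R (p + x) + v *\<^sub>R (p + y) = (u + v) *\<^sub>R p + (u *\<^sub>R x + v *\<^sub>R y)"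
      by (simp add: algebra_simps)
    then have "f (p + (u *\<^sub>R x + v *\<^sub>R y)) = u *\<^sub>R f (p + x) + v *\<^sub>R f (p + y)"
      using affine_map_onD[OF f that] that(5) by simp
    then have "g (u *\<^sub>R x + v *\<^sub>R y) = u *\<^sub>R f (p + x) + v *\<^sub>R f (p + y) - (u + v) *\<^sub>R f p"
      using that(5) by (simp add: g_def)
    then show ?thesis by (simp add: g_def algebra_simps)
  qed
  have sc: "g (u *\<^sub>R x) = u *\<^sub>R g x" if "p + x \<in> S" "0 \<le> u" "u \<le> 1" for x u
    using conv[of x 0 u "1 - u"] that pS by (simp add: g_def)
  \<comment> \<open>Every multiple of \<open>x\<close> by a factor between 0 and \<open>r x\<close>
    has norm below \<open>e\<close>; the summand 1 keeps the denominator positive at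
    \<open>x = 0\<close>.\<close>
  define r where "r x = e / (2 * (1 + norm x))" for x :: 'a
  have r: "0 < r x" "norm (c *\<^sub>R x) < e" if "0 \<le> c" "c \<le> r x" for x c
  proof -
    have n: "0 < 1 + norm x" by (simp add: add_pos_nonneg)
    show "0 < r x" using e n by (simp add: r_def)
    have "c * norm x \<le> r x * norm x" using that by (intro mult_right_mono) auto
    also have "\<dots> < e"
    proof -
      have "s < 2 * (1 + s)" if "0 \<le> s" for s :: real using that by simp
      from this[OF norm_ge_zero] have "e * norm x < e * (2 * (1 + norm x))" using e(1) by (rule mult_strict_left_mono)
      then show ?thesis using n by (simp add: r_def pos_divide_less_eq)
    qed
    finally show "norm (c *\<^sub>R x) < e" using that by simp
  qed
  have r0: "0 < r x" for x using r(1)[of 0] e by (simp add: r_def add_pos_nonneg)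
  \<comment> \<open>The slope of \<open>g\<close> along the ray from \<open>p\<close> in direction
    \<open>x\<close>. By \<open>sc\<close>, any positive multiple of \<open>x\<close> that stays in
    \<open>S\<close> gives the same slope.\<close>
  define L where "L x = (1 / r x) *\<^sub>R g (r x *\<^sub>R x)" for x
  have L: "g (c *\<^sub>R x) = c *\<^sub>R L x" if "0 < c" "p + c *\<^sub>R x \<in> S" for x c
  proof (cases "c \<le> r x")
    case True
    have "p + r x *\<^sub>R x \<in> S" using r[of "r x" x] r0[of x] by (intro near) auto
    then have "g ((c / r x) *\<^sub>R (r x *\<^sub>R x)) = (c / r x) *\<^sub>R g (r x *\<^sub>R x)"
      using that r0[of x] True by (intro sc) auto
    then show ?thesis using r0[of x] by (simp add: L_def)
  next
    case False
    have "g ((r x / c) *\<^sub>R (c *\<^sub>R x)) = (r x / c) *\<^sub>R g (c *\<^sub>R x)"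
      using that r0[of x] False by (intro sc) auto
    then show ?thesis using r0[of x] that by (simp add: L_def)
  qed
  have add: "L (x + y) = L x + L y" for x y
  proof -
    \<comment> \<open>Additivity comes from a midpoint: the factors that occur are
      \<open>2 * c\<close> for \<open>x\<close> and \<open>y\<close> and \<open>c\<close> for
      \<open>x + y\<close>, and all of them must be admissible.\<close>
    define c where "c = min (r (x + y)) (min (r x) (r y)) / 2"
    have c: "0 < c" "c \<le> r (x + y)" "2 * c \<le> r x" "2 * c \<le> r y"
      using r0[of x] r0[of y] r0[of "x + y"] by (auto simp: c_def)
    have "c *\<^sub>R L (x + y) = g (c *\<^sub>R (x + y))"
      using c r(2)[of c "x + y"] by (intro L[symmetric] near) auto
    also have "c *\<^sub>R (x + y) = (1/2) *\<^sub>R ((2 * c) *\<^sub>R x) + (1/2) *\<^sub>R ((2 * c) *\<^sub>R y)"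
      by (simp add: scaleR_add_right)
    also have "g \<dots> = (1/2) *\<^sub>R g ((2 * c) *\<^sub>R x) + (1/2) *\<^sub>R g ((2 * c) *\<^sub>R y)"
      using c r(2)[of "2 * c" x] r(2)[of "2 * c" y] by (intro conv near) auto
    also have "\<dots> = (1/2) *\<^sub>R ((2 * c) *\<^sub>R L x) + (1/2) *\<^sub>R ((2 * c) *\<^sub>R L y)"
      using c r(2)[of "2 * c" x] r(2)[of "2 * c" y] by (subst (1 2) L) (auto intro!: near)
    also have "\<dots> = c *\<^sub>R (L x + L y)" by (simp add: scaleR_add_right)
    finally show ?thesis using c by simp
  qed
  have scp: "L (u *\<^sub>R x) = u *\<^sub>R L x" if "0 < u" for u x
  proof -
    define c where "c = min (r (u *\<^sub>R x)) (r x / u)"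
    have c: "0 < c" "c \<le> r (u *\<^sub>R x)" "c * u \<le> r x"
      using r0[of x] r0[of "u *\<^sub>R x"] that by (auto simp: c_def field_simps min_def)
    have "c *\<^sub>R L (u *\<^sub>R x) = g (c *\<^sub>R (u *\<^sub>R x))"
      using c r(2)[of c "u *\<^sub>R x"] by (intro L[symmetric] near) auto
    also have "\<dots> = g ((c * u) *\<^sub>R x)" by simp
    also have "\<dots> = (c * u) *\<^sub>R L x"
      using c that r(2)[of "c * u" x] by (intro L near) auto
    finally have "c *\<^sub>R L (u *\<^sub>R x) = c *\<^sub>R (u *\<^sub>R L x)"
      by (simp only: scaleR_scaleR)
    then show ?thesis using c(1) by (simp only: scaleR_cancel_left) simp
  qed
  have L0: "L 0 = 0" using add[of 0 0] by simp
  have neg: "L (- x) = - L x" for x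
    using add[of x "- x"] L0 by (simp add: eq_neg_iff_add_eq_0 add.commute)
  have "L (u *\<^sub>R x) = u *\<^sub>R L x" for u x
  proof (cases "u > 0")
    case False
    show ?thesis
    proof (cases "u = 0")
      case nz: False
      then show ?thesis using False scp[of "- u" x] neg[of "u *\<^sub>R x"] by simp
    qed (simp add: L0)
  qed (rule scp)
  with add have lin: "linear L" by (intro linearI)
  have "f x = L x + (f p - L p)" if "x \<in> S" for x
  proof -
    have "g (x - p) = L (x - p)" using L[of 1 "x - p"] that by simp
    then show ?thesis by (simp add: g_def linear_diff[OF lin] algebra_simps)
  qed
  then show ?thesis using that lin by blast
qed

text \<open>After a translation taking \<open>p\<close> to 0, the span of \<open>S\<close> has the
  dimension of the target, hence is mapped onto it by a linear isometry. The relative interior of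
  the image, nonempty by convexity, is then its interior.\<close>

lemma affine_isomorphic_full_dimensional:
  fixes S :: "'a::euclidean_space set"
  assumes S: "compact S" "convex S" and dim: "aff_dim S = DIM('b::euclidean_space)"
  obtains T :: "'b::euclidean_space set" where "compact T" "convex T" "interior T \<noteq> {}" "affine_isomorphic S T"
proof -
  have "S \<noteq> {}" using dim by auto
  then obtain p where p: "p \<in> S" by auto
  define X where "X = (\<lambda>x. x - p) ` S"
  have dX: "dim X = DIM('b)"
    using aff_dim_eq_dim_subtract[OF hull_inc[OF p]] dim by (simp add: X_def)
  then have "dim (span X) = dim (UNIV :: 'b set)" by simp
  then obtain f :: "'a \<Rightarrow> 'b" where f: "linear f" "f ` span X = UNIV"
      and nf: "\<And>x. x \<in> span X \<Longrightarrow> norm (f x) = norm x"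
    by (rule isometry_subspaces[OF subspace_span subspace_UNIV]) (rule that)
  have inj: "inj_on f (span X)"
    using linear_inj_on_iff_eq_0[OF f(1) subspace_span] nf by (metis norm_eq_zero)
  let ?h = "\<lambda>x. f x + f (- p)"
  have h: "?h x = f (x - p)" for x by (simp add: linear_diff[OF f(1)] linear_neg[OF f(1)])
  define T where "T = ?h ` S"
  have TX: "T = f ` X" by (auto simp: T_def X_def h image_image)
  have "inj_on f S"
  proof (rule inj_onI)
    fix x y assume "x \<in> S" "y \<in> S" "f x = f y"
    then have "x - p \<in> span X" "y - p \<in> span X" "f (x - p) = f (y - p)"
      by (auto simp: X_def linear_diff[OF f(1)] intro: span_base)
    then show "x = y" using inj_onD[OF inj, of "x - p" "y - p"] by simp
  qed
  then have "affine_isomorphic S T" unfolding T_def by (rule affine_isomorphic_linear_image[OF f(1)])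
  moreover have "compact T" unfolding TX X_def using S(1) f(1)
    by (intro compact_continuous_image compact_translation_subtract linear_continuous_on)
      (simp_all add: linear_conv_bounded_linear)
  moreover have "convex T" unfolding TX X_def using S(2) f(1)
    by (intro convex_linear_image convex_translation_subtract)
  moreover have "interior T \<noteq> {}"
  proof -
    have "0 \<in> X" using p by (auto simp: X_def)
    then have "0 \<in> T" using linear_0[OF f(1)] by (force simp: TX)
    then have "aff_dim T = int (dim T)" by (intro aff_dim_zero hull_inc)
    also have "dim T = DIM('b)" unfolding TX using dim_image_eq[OF f(1) inj] dX by simp
    finally have "interior T = rel_interior T" by (simp add: interior_rel_interior_gen)
    then show ?thesis using rel_interior_eq_empty[OF \<open>convex T\<close>] \<open>0 \<in> T\<close> by auto
  qed
  ultimately show ?thesis using that by blast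
qed

lemma extreme_point_of_injective_affine_image:
  assumes "affine_map_on S f" "inj_on f S" "convex S" "y extreme_point_of (f ` S)"
  obtains x where "x extreme_point_of S" "f x = y"
proof -
  have bij: "bij_betw f S (f ` S)" using assms(2) by (simp add: bij_betw_def)
  have img: "inv_into S f ` f ` S = S" using assms(2) by (simp add: inv_into_image_cancel)
  have inj: "inj_on (inv_into S f) (f ` S)" using bij_betw_inv_into[OF bij] by (simp add: bij_betw_def)
  have "convex (f ` S)"
    unfolding convex_def
  proof (intro ballI allI impI)
    fix x y and u v :: real
    assume "x \<in> f ` S" "y \<in> f ` S" and uv: "0 \<le> u" "0 \<le> v" "u + v = 1"
    then obtain p q where pq: "p \<in> S" "q \<in> S" "x = f p" "y = f q" by blast
    have "u *\<^sub>R p + v *\<^sub>R q \<in> S" using assms(3) pq uv by (simp add: convex_def)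
    then show "u *\<^sub>R x + v *\<^sub>R y \<in> f ` S"
      using affine_map_onD[OF assms(1) pq(1,2) uv] pq by (metis imageI)
  qed
  then have "inv_into S f y extreme_point_of S"
    using extreme_point_of_affine_image[OF affine_map_on_inverse[OF assms(1) bij assms(3)] inj
        subset_refl _ assms(4)] img by simp
  moreover have "f (inv_into S f y) = y"
    using assms(4) by (intro f_inv_into_f) (simp add: extreme_point_of_def)
  ultimately show ?thesis using that by blast
qed

section \<open>Centroid and covariance form\<close>

lemma absolutely_integrable_continuous_compact:
  fixes f :: "'a::euclidean_space \<Rightarrow> 'b::euclidean_space"
  assumes "compact S" "continuous_on S f"
  shows "f absolutely_integrable_on S"
proof -
  have int: "integrable lborel (\<lambda>x. indicator S x *\<^sub>R f x)"
    using borel_integrable_compact[OF assms] .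
  show ?thesis
    unfolding set_integrable_def
    using integrable_completion[OF borel_measurable_integrable[OF int]] int by blast
qed

text \<open>A box around the point has its integral squeezed between 0 and that over
  \<open>S\<close>. Used for the volume being nonzero and for the covariance form being
  definite.\<close>

lemma integral_continuous_eq_0_imp:
  fixes f :: "'a::euclidean_space \<Rightarrow> real"
  assumes "compact S" "continuous_on S f" "\<And>x. x \<in> S \<Longrightarrow> 0 \<le> f x"
    and "integral S f = 0" "x \<in> interior S"
  shows "f x = 0"
proof -
  obtain a b where ab: "cbox a b \<subseteq> interior S" "x \<in> box a b"
    using open_contains_cbox assms(5) by (metis open_interior)
  have sub: "cbox a b \<subseteq> S" using ab interior_subset by blast
  have cont: "continuous_on (cbox a b) f"
    using assms(2) sub continuous_on_subset by blast
  have "f integrable_on S"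
    using absolutely_integrable_continuous_compact[OF assms(1,2)] absolutely_integrable_on_def by blast
  then have "integral (cbox a b) f \<le> integral S f"
    using sub cont assms(3) by (intro integral_subset_le integrable_continuous) auto
  moreover have "0 \<le> integral (cbox a b) f"
    using sub assms(3) cont by (intro integral_nonneg integrable_continuous) auto
  ultimately have "integral (cbox a b) f = 0" using assms(4) by simp
  moreover have "box a b \<noteq> {}" using ab by auto
  moreover have "x \<in> cbox a b" using ab box_subset_cbox by blast
  ultimately show ?thesis
    using integral_cbox_eq_0_iff[OF cont] assms(3) sub by blast
qed

lemma integral_affine_image:
  fixes f :: "real^'n::{finite,wellorder} \<Rightarrow> real^'m" and L :: "real^'n::_ \<Rightarrow> real^'n::_"
  assumes "compact S" "linear L" "inj L" and S: "(\<lambda>x. L x + b) ` S = S" and "continuous_on S f"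
  shows "integral S f = \<bar>det (matrix L)\<bar> *\<^sub>R integral S (\<lambda>x. f (L x + b))"
proof -
  have "f absolutely_integrable_on (\<lambda>x. L x + b) ` S"
    unfolding S using assms by (intro absolutely_integrable_continuous_compact)
  moreover have "((\<lambda>x. L x + b) has_derivative L) (at x within S)" for x
    using linear_imp_has_derivative[OF assms(2)] by (auto intro!: derivative_eq_intros)
  moreover have "inj_on (\<lambda>x. L x + b) S"
    using assms(3) by (auto simp: inj_on_def)
  ultimately have "integral S (\<lambda>x. \<bar>det (matrix L)\<bar> *\<^sub>R f (L x + b)) = integral S f"
    using has_absolute_integral_change_of_variables_compact[OF assms(1),
        of "\<lambda>x. L x + b" "\<lambda>_. L" f "integral S f"] S by auto
  then show ?thesis by simp
qed

text \<open>Gram-Schmidt for \<open>B\<close>, started from the standard basis; \<open>T\<close>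
  sends the standard basis to the resulting \<open>B\<close>-orthonormal family.\<close>

lemma orthonormal_basis_bilinear:
  fixes B :: "'a::euclidean_space \<Rightarrow> 'a \<Rightarrow> real"
  assumes bil: "bilinear B" and sym: "\<And>x y. B x y = B y x" and pos: "\<And>x. x \<noteq> 0 \<Longrightarrow> 0 < B x x"
  obtains T :: "'a \<Rightarrow> 'a" where "linear T" "inj T" "\<And>x y. B (T x) (T y) = x \<bullet> y"
proof -
  \<comment> \<open>The span condition belongs to the induction: it shows that the next basis vector
    is not a combination of the vectors already built, so the remainder \<open>w\<close> is nonzero
    and can be normalized.\<close>
  have "\<exists>b :: 'a \<Rightarrow> 'a. b ` D \<subseteq> span D \<and> (\<forall>i\<in>D. \<forall>j\<in>D. B (b i) (b j) = (if i = j then 1 else 0))"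
    if "finite D" "D \<subseteq> Basis" for D :: "'a set"
    using that
  proof (induction D rule: finite_induct)
    case (insert e D)
    then obtain b where b: "b ` D \<subseteq> span D"
      and on: "\<And>i j. i \<in> D \<Longrightarrow> j \<in> D \<Longrightarrow> B (b i) (b j) = (if i = j then 1 else 0)"
      by auto
    define w where "w = e - (\<Sum>i\<in>D. B e (b i) *\<^sub>R b i)"
    have sp: "(\<Sum>i\<in>D. B e (b i) *\<^sub>R b i) \<in> span D"
      using b by (intro span_sum span_scale) auto
    have "e \<notin> span D"
      using independent_insert[of e D] independent_mono[OF independent_Basis insert.prems] insert.hyps
      by auto
    then have "w \<noteq> 0" using sp by (auto simp: w_def)
    then have ww: "0 < B w w" by (rule pos)
    have ort: "B w (b j) = 0" if "j \<in> D" for j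
    proof -
      have "B (\<Sum>i\<in>D. B e (b i) *\<^sub>R b i) (b j) = (\<Sum>i\<in>D. B e (b i) * B (b i) (b j))"
        using linear_sum[of "\<lambda>x. B x (b j)" "\<lambda>i. B e (b i) *\<^sub>R b i" D] bil
        by (simp add: bilinear_def linear_cmul[of "\<lambda>x. B x (b j)"])
      also have "\<dots> = (\<Sum>i\<in>D. if i = j then B e (b i) else 0)"
        using on that by (intro sum.cong) auto
      also have "\<dots> = B e (b j)" using insert.hyps that by simp
      finally show ?thesis using bil by (simp add: w_def bilinear_lsub)
    qed
    define b' where "b' = b(e := (1 / sqrt (B w w)) *\<^sub>R w)"
    have "b' ` insert e D \<subseteq> span (insert e D)"
    proof -
      have "w \<in> span (insert e D)"
        unfolding w_def using sp span_mono[of D "insert e D"]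
        by (intro span_diff) (auto intro: span_base)
      then show ?thesis
        using b span_mono[of D "insert e D"] insert.hyps by (auto simp: b'_def intro: span_scale)
    qed
    moreover have "B (b' i) (b' j) = (if i = j then 1 else 0)"
      if "i \<in> insert e D" "j \<in> insert e D" for i j
    proof -
      have "B (b' e) (b' e) = 1"
        using ww bil by (simp add: b'_def bilinear_lmul bilinear_rmul)
      moreover have "B (b' e) (b j) = 0" "B (b j) (b' e) = 0" if "j \<in> D" for j
        using ort[OF that] bil sym by (simp_all add: b'_def bilinear_lmul bilinear_rmul)
      moreover have "b' j = b j" if "j \<in> D" for j
        using that insert.hyps by (auto simp: b'_def)
      ultimately show ?thesis
        using that on insert.hyps by auto
    qed
    ultimately show ?case by blast
  qed auto
  from this[OF finite_Basis subset_refl] obtain b :: "'a \<Rightarrow> 'a"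
    where "\<forall>i\<in>Basis. \<forall>j\<in>Basis. B (b i) (b j) = (if i = j then 1 else 0)"
    by blast
  then have on: "B (b i) (b j) = (if i = j then 1 else 0)" if "i \<in> Basis" "j \<in> Basis" for i j
    using that by metis
  define T where "T x = (\<Sum>i\<in>Basis. ((x :: 'a) \<bullet> i) *\<^sub>R b i)" for x
  have "linear T"
    unfolding T_def by (intro linearI)
      (auto simp: inner_add_left scaleR_add_left sum.distrib scaleR_sum_right)
  moreover have BT: "B (T x) (T y) = x \<bullet> y" for x y
  proof -
    have "B (T x) (T y) = (\<Sum>i\<in>Basis. \<Sum>j\<in>Basis. (x \<bullet> i) * ((y \<bullet> j) * B (b i) (b j)))"
      unfolding T_def bilinear_sum[OF bil] sum.cartesian_product
      by (simp add: bilinear_lmul[OF bil] bilinear_rmul[OF bil] mult.left_commute)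
    also have "\<dots> = (\<Sum>i\<in>Basis. \<Sum>j\<in>Basis. if i = j then (x \<bullet> i) * (y \<bullet> j) else 0)"
      using on by (intro sum.cong) auto
    also have "\<dots> = x \<bullet> y" by (simp add: euclidean_inner[of x y])
    finally show ?thesis .
  qed
  moreover have "inj T"
    unfolding linear_injective_0[OF \<open>linear T\<close>]
  proof (intro allI impI)
    fix x assume "T x = 0"
    then have "x \<bullet> x = B 0 0" using BT[of x x] by simp
    also have "\<dots> = 0" using bil by (simp add: bilinear_lzero)
    finally show "x = 0" by simp
  qed
  ultimately show ?thesis using that by blast
qed

text \<open>Preservation of the inner product makes the adjoint a left inverse, hence the
  inverse.\<close>

lemma orthogonal_transformation_adjoint:
  fixes h :: "'a::euclidean_space \<Rightarrow> 'a"
  assumes "orthogonal_transformation h"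
  shows "orthogonal_transformation (adjoint h)"
proof -
  have lin: "linear h" using assms by (rule orthogonal_transformation_linear)
  have "adjoint h (h x) = x" for x
    using assms lin
    by (intro vector_eq_rdot[THEN iffD1])
      (auto simp: adjoint_clauses(2)[OF lin] orthogonal_transformation_def)
  then have "adjoint h = inv_into UNIV h"
    using orthogonal_transformation_bij[OF assms] by (metis bij_inv_eq_iff ext)
  then show ?thesis using orthogonal_transformation_inv[OF assms] by simp
qed

text \<open>The point \<open>c\<close> is the centroid of \<open>S\<close>, and \<open>N\<close> turns the covariance form
  of \<open>S\<close> into the standard inner product; both are preserved by every affine automorphism.\<close>

lemma affine_automorphisms_orthogonalizable:
  fixes S :: "(real^'n::{finite,wellorder}) set"
  assumes S: "compact S" "interior S \<noteq> {}"
  obtains c and N :: "real^'n::_ \<Rightarrow> real^'n::_" where "linear N" "inj N"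
    "\<And>L b. \<lbrakk>linear L; (\<lambda>x. L x + b) ` S = S; inj L\<rbrakk> \<Longrightarrow>
       \<exists>f. orthogonal_transformation f \<and> (\<forall>x. N (L x + b - c) = f (N (x - c)))"
proof -
  define vol where "vol = integral S (\<lambda>_. 1 :: real)"
  obtain p where p: "p \<in> interior S" using S by auto
  have vol: "vol \<noteq> 0"
    using integral_continuous_eq_0_imp[OF S(1), of "\<lambda>_. 1" p] p by (auto simp: vol_def)
  have ints: "f integrable_on S" if "continuous_on S f" for f :: "real^'n::_ \<Rightarrow> 'b::euclidean_space"
    using absolutely_integrable_continuous_compact[OF S(1) that] absolutely_integrable_on_def by blast
  have const: "integral S (\<lambda>_. v) = vol *\<^sub>R v" for v :: "real^'n::_"
    using integral_linear[OF ints[of "\<lambda>_. 1::real"] bounded_linear_scaleR_left[of v]]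
    by (simp add: o_def vol_def)
  define c where "c = (1 / vol) *\<^sub>R integral S (\<lambda>x. x)"
  \<comment> \<open>The integral of a nonzero constant measures the volume, which \<open>L\<close>
    multiplies by the modulus of its determinant. The constant is a vector because
    \<open>integral_affine_image\<close> is stated for vector values.\<close>
  have det: "\<bar>det (matrix L)\<bar> = 1"
    if "linear L" "(\<lambda>x. L x + b) ` S = S" "inj L" for L b
  proof -
    obtain v :: "real^'n::_" where "v \<noteq> 0" using vector_choose_size[of 1] by (metis norm_zero zero_neq_one zero_le_one)
    moreover have "vol *\<^sub>R v = \<bar>det (matrix L)\<bar> *\<^sub>R (vol *\<^sub>R v)"
      using integral_affine_image[OF S(1) that(1,3,2), of "\<lambda>_. v"] const by simp
    ultimately show ?thesis using vol by simp
  qed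
  have change: "integral S f = integral S (\<lambda>x. f (L x + b))"
    if "linear L" "(\<lambda>x. L x + b) ` S = S" "inj L" "continuous_on S f" for L b and f :: "real^'n::_ \<Rightarrow> real^'n::_"
    using integral_affine_image[OF S(1) that(1,3,2,4)] det[OF that(1-3)] by simp
  have c: "L c + b = c" if L: "linear L" "(\<lambda>x. L x + b) ` S = S" "inj L" for L b
  proof -
    have "integral S (\<lambda>x. x) = integral S (\<lambda>x. L x + b)"
      using change[OF L, of "\<lambda>x. x"] by simp
    also have "\<dots> = L (integral S (\<lambda>x. x)) + vol *\<^sub>R b"
      using L(1) integral_linear[OF ints[of "\<lambda>x. x"], of L]
      by (subst integral_add) (auto simp: const o_def linear_conv_bounded_linear
          intro!: ints linear_continuous_on continuous_intros)
    finally have "vol *\<^sub>R c = vol *\<^sub>R (L c + b)"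
      using vol L(1) by (simp add: c_def linear_cmul scaleR_add_right)
    then show ?thesis using vol by simp
  qed
  \<comment> \<open>The covariance operator. Keeping it vector-valued lets \<open>change\<close> be
    applied to its integrand; the form \<open>B\<close> is obtained by pairing with a second
    vector.\<close>
  define M where "M u = integral S (\<lambda>x. (u \<bullet> (x - c)) *\<^sub>R (x - c))" for u
  have ci: "continuous_on S (\<lambda>x. (u \<bullet> (x - c)) *\<^sub>R (x - c))" for u
    by (intro continuous_intros)
  have linM: "linear M"
    by (intro linearI)
      (simp_all add: M_def inner_add_left scaleR_add_left integral_add[OF ints ints] ci flip: scaleR_scaleR)
  define B where "B u v = M u \<bullet> v" for u v
  have Bint: "B u v = integral S (\<lambda>x. (u \<bullet> (x - c)) * (v \<bullet> (x - c)))" for u v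
    using integral_linear[OF ints[OF ci] bounded_linear_inner_left[of v]]
    by (simp add: B_def M_def o_def inner_commute)
  have bil: "bilinear B"
    using linM unfolding bilinear_def B_def
    by (auto intro!: linearI simp: linear_add linear_cmul inner_add_left inner_add_right)
  have sym: "B u v = B v u" for u v
    by (simp add: Bint mult.commute)
  have pos: "0 < B u u" if "u \<noteq> 0" for u
  proof -
    have "0 \<le> B u u"
      unfolding Bint by (intro integral_nonneg ints continuous_intros) auto
    moreover have "B u u \<noteq> 0"
    proof
      assume "B u u = 0"
      then have z: "u \<bullet> (x - c) = 0" if "x \<in> interior S" for x
        using integral_continuous_eq_0_imp[OF S(1), of "\<lambda>x. (u \<bullet> (x - c)) * (u \<bullet> (x - c))" x] that
        by (force simp: Bint intro!: continuous_intros)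
      obtain e where e: "e > 0" "ball p e \<subseteq> interior S"
        using p open_contains_ball[of "interior S"] by auto
      \<comment> \<open>A point at distance \<open>e / 2\<close> from \<open>p\<close> in direction
        \<open>u\<close>: the functional \<open>u \<bullet> (x - c)\<close> differs at
        \<open>p\<close> and \<open>q\<close>, so it cannot vanish at both.\<close>
      define q where "q = p + (e / (2 * norm u)) *\<^sub>R u"
      have "q \<in> interior S"
        using e that by (auto intro!: subsetD[OF e(2)] simp: q_def dist_norm)
      from z[OF this] z[OF p] have "(e / (2 * norm u)) * (u \<bullet> u) = 0"
        by (simp add: q_def inner_diff_right inner_add_right)
      then show False using e that by simp
    qed
    ultimately show ?thesis by simp
  qed
  obtain T :: "real^'n::_ \<Rightarrow> real^'n::_" where T: "linear T" "inj T" "\<And>x y. B (T x) (T y) = x \<bullet> y"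
    by (rule orthonormal_basis_bilinear[OF bil sym pos]) (assumption, rule that)
  \<comment> \<open>The form \<open>B\<close> is invariant under the adjoint \<open>K\<close> of
    \<open>L\<close>, so conjugating \<open>K\<close> by \<open>T\<close> gives an orthogonal
    \<open>h\<close>. Taking adjoints in \<open>T \<circ> h = K \<circ> T\<close> shows that it is
    the adjoint of \<open>T\<close> that conjugates \<open>L\<close> itself to an orthogonal
    map.\<close>
  define N where "N = adjoint T"
  have surjT: "surj T" by (rule eucl.linear_inj_imp_surj[OF T(1,2)])
  have "linear N" unfolding N_def by (rule adjoint_linear[OF T(1)])
  moreover have "inj N"
    unfolding linear_injective_0[OF \<open>linear N\<close>]
  proof (intro allI impI)
    fix x assume "N x = 0"
    then have "x \<bullet> T y = 0" for y using adjoint_clauses(2)[OF T(1), of x y] by (simp add: N_def)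
    then show "x = 0" using surjT by (metis inner_eq_zero_iff surjD)
  qed
  moreover have "\<exists>f. orthogonal_transformation f \<and> (\<forall>x. N (L x + b - c) = f (N (x - c)))"
    if L: "linear L" "(\<lambda>x. L x + b) ` S = S" "inj L" for L b
  proof -
    define K where "K = adjoint L"
    have K: "linear K" "x \<bullet> K y = L x \<bullet> y" for x y
      using adjoint_linear[OF L(1)] adjoint_works[OF L(1)] by (auto simp: K_def)
    then have K': "K u \<bullet> x = u \<bullet> L x" for u x by (metis inner_commute)
    have Lc: "L x + b - c = L (x - c)" for x
      using c[OF L] L(1) by (simp add: linear_diff algebra_simps)
    \<comment> \<open>The substitution of \<open>L x + b\<close>, which fixes \<open>c\<close>,
      turns each factor \<open>x - c\<close> into its image under \<open>L\<close>: one
      \<open>L\<close> leaves the integral, the other moves to \<open>u\<close> as its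
      adjoint.\<close>
    have M: "M u = L (M (K u))" for u
    proof -
      have "M u = integral S (\<lambda>x. (u \<bullet> L (x - c)) *\<^sub>R L (x - c))"
        using change[OF L ci, of u] by (simp add: M_def Lc)
      also have "\<dots> = integral S (L \<circ> (\<lambda>x. (K u \<bullet> (x - c)) *\<^sub>R (x - c)))"
        by (simp add: o_def linear_cmul[OF L(1)] K')
      also have "\<dots> = L (M (K u))"
        unfolding M_def using L(1) by (intro integral_linear ints ci) (simp add: linear_conv_bounded_linear)
      finally show ?thesis .
    qed
    have BK: "B (K u) (K v) = B u v" for u v
      by (simp add: B_def K(2) flip: M)
    define h where "h = inv_into UNIV T \<circ> K \<circ> T"
    have Th: "T (h x) = K (T x)" for x
      using surjT by (simp add: h_def surj_f_inv_f)
    have "linear (inv_into UNIV T)" using T inj_linear_imp_inv_linear by blast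
    then have "linear h" unfolding h_def using T(1) K(1) by (intro linear_compose)
    then have h: "orthogonal_transformation h"
      unfolding orthogonal_transformation_def using BK Th by (simp flip: T(3))
    have "N (L x) = adjoint h (N x)" for x
    proof (rule vector_eq_rdot[THEN iffD1], intro allI)
      fix u
      have "N (L x) \<bullet> u = x \<bullet> T (h u)"
        unfolding Th by (simp add: N_def adjoint_clauses[OF T(1)] K(2))
      also have "\<dots> = adjoint h (N x) \<bullet> u"
        by (simp add: N_def adjoint_clauses[OF T(1)] adjoint_clauses[OF \<open>linear h\<close>])
      finally show "N (L x) \<bullet> u = adjoint h (N x) \<bullet> u" .
    qed
    then show ?thesis
      using orthogonal_transformation_adjoint[OF h] Lc by auto
  qed
  ultimately show ?thesis using that by blast
qed

section \<open>Rotations about an axis\<close>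

unbundle cross3_syntax

text \<open>Rodrigues' formula: for a unit vector \<open>a\<close>, the rotation by the angle
  \<open>t\<close> about the oriented axis \<open>a\<close>.\<close>

definition rotation_about :: "real^3 \<Rightarrow> real \<Rightarrow> real^3 \<Rightarrow> real^3" where
  "rotation_about a t x = (a \<bullet> x) *\<^sub>R a + cos t *\<^sub>R (x - (a \<bullet> x) *\<^sub>R a) + sin t *\<^sub>R (a \<times> x)"

lemma linear_rotation_about: "linear (rotation_about a t)"
  by (intro linearI)
    (simp_all add: rotation_about_def inner_add_right cross_add_right cross_mult_right algebra_simps)

lemma inner_rotation_about:
  assumes "norm a = 1"
  shows "a \<bullet> rotation_about a t x = a \<bullet> x"
  using assms by (simp add: rotation_about_def inner_add_right inner_diff_right dot_cross_self norm_eq_1)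

lemma cross_rotation_about:
  assumes "norm a = 1"
  shows "a \<times> rotation_about a t x = cos t *\<^sub>R (a \<times> x) - sin t *\<^sub>R (x - (a \<bullet> x) *\<^sub>R a)"
  using assms by (simp add: rotation_about_def cross_add_right Cross3.right_diff_distrib
      cross_mult_right Lagrange norm_eq_1 algebra_simps)

lemma rotation_about_add:
  assumes "norm a = 1"
  shows "rotation_about a s (rotation_about a t x) = rotation_about a (s + t) x"
proof -
  have "rotation_about a s (rotation_about a t x) = (a \<bullet> x) *\<^sub>R a
      + cos s *\<^sub>R (rotation_about a t x - (a \<bullet> x) *\<^sub>R a) + sin s *\<^sub>R (a \<times> rotation_about a t x)"
    using assms by (simp add: rotation_about_def[of a s] inner_rotation_about)
  also have "rotation_about a t x - (a \<bullet> x) *\<^sub>R a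
      = cos t *\<^sub>R (x - (a \<bullet> x) *\<^sub>R a) + sin t *\<^sub>R (a \<times> x)"
    by (simp add: rotation_about_def)
  finally show ?thesis
    unfolding cross_rotation_about[OF assms] rotation_about_def[of a "s + t"] cos_add sin_add
    by (simp add: algebra_simps)
qed

lemma rotation_about_0 [simp]: "rotation_about a 0 x = x"
  by (simp add: rotation_about_def)

lemma rotation_about_periodic: "rotation_about a (t + 2 * pi * real k) x = rotation_about a t x"
proof -
  have "cos (2 * pi * real k) = 1" "sin (2 * pi * real k) = 0"
    using cos_2npi[of k] sin_2npi[of k] by (simp_all add: mult.commute mult.left_commute)
  then have "cos (t + 2 * pi * real k) = cos t" "sin (t + 2 * pi * real k) = sin t"
    by (simp_all add: cos_add sin_add)
  then show ?thesis by (simp add: rotation_about_def)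
qed

lemma orthogonal_rotation_about:
  assumes "norm a = 1"
  shows "orthogonal_transformation (rotation_about a t)"
  unfolding orthogonal_transformation
proof (intro conjI allI linear_rotation_about)
  fix x
  define w v where "w = x - (a \<bullet> x) *\<^sub>R a" and "v = a \<times> x"
  have aa: "a \<bullet> a = 1" using assms by (simp add: norm_eq_1)
  have o: "a \<bullet> w = 0" "a \<bullet> v = 0" "w \<bullet> v = 0"
    using aa by (simp_all add: w_def v_def inner_diff_right inner_diff_left dot_cross_self)
  have ww: "w \<bullet> w = x \<bullet> x - (a \<bullet> x)\<^sup>2"
    using aa by (simp add: w_def inner_diff_left inner_diff_right inner_commute power2_eq_square)
  have vv: "v \<bullet> v = x \<bullet> x - (a \<bullet> x)\<^sup>2"
    using aa by (simp add: v_def dot_cross inner_commute power2_eq_square)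
  have "rotation_about a t x \<bullet> rotation_about a t x
      = (a \<bullet> x)\<^sup>2 + (cos t)\<^sup>2 * (w \<bullet> w) + (sin t)\<^sup>2 * (v \<bullet> v)"
    unfolding rotation_about_def w_def[symmetric] v_def[symmetric] using o aa
    by (simp add: inner_add_left inner_add_right inner_commute[of w a] inner_commute[of v a]
        inner_commute[of v w] power2_eq_square)
  also have "\<dots> = (a \<bullet> x)\<^sup>2 + ((cos t)\<^sup>2 + (sin t)\<^sup>2) * (x \<bullet> x - (a \<bullet> x)\<^sup>2)"
    unfolding ww vv by (simp only: distrib_right add.assoc)
  also have "\<dots> = x \<bullet> x" by simp
  finally show "norm (rotation_about a t x) = norm x" by (simp add: norm_eq_sqrt_inner)
qed

lemma rotation_about_funpow:
  assumes "norm a = 1"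
  shows "(rotation_about a t ^^ k) x = rotation_about a (real k * t) x"
  by (induction k) (simp_all add: rotation_about_add[OF assms] algebra_simps)

lemma tendsto_rotation_about:
  assumes "(a \<longlongrightarrow> l) F" "(t \<longlongrightarrow> s) F"
  shows "((\<lambda>n. rotation_about (a n) (t n) x) \<longlongrightarrow> rotation_about l s x) F"
proof -
  have "((\<lambda>n. a n \<times> x) \<longlongrightarrow> l \<times> x) F"
    by (intro bounded_linear.tendsto[OF _ assms(1), of "\<lambda>y. y \<times> x"])
      (simp add: linear_conv_bounded_linear[symmetric] linearI cross_add_left cross_mult_left)
  then show ?thesis
    unfolding rotation_about_def using assms
    by (intro tendsto_intros isCont_tendsto_compose[OF isCont_cos] isCont_tendsto_compose[OF isCont_sin])
qed

text \<open>The remainder \<open>d\<close> is orthogonal to \<open>a\<close> and \<open>u\<close>,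
  so Lagrange's formula makes its cross product with \<open>v\<close> vanish. It is also orthogonal
  to the nonzero \<open>v\<close>, hence 0.\<close>

lemma orthonormal_expansion_cross:
  fixes a u w :: "real^3"
  assumes "norm a = 1" "norm u = 1" "a \<bullet> u = 0"
  shows "w = (a \<bullet> w) *\<^sub>R a + (u \<bullet> w) *\<^sub>R u + ((a \<times> u) \<bullet> w) *\<^sub>R (a \<times> u)"
proof -
  define v where "v = a \<times> u"
  define d where "d = w - ((a \<bullet> w) *\<^sub>R a + (u \<bullet> w) *\<^sub>R u + (v \<bullet> w) *\<^sub>R v)"
  have aa: "a \<bullet> a = 1" "u \<bullet> u = 1" "u \<bullet> a = 0"
    using assms by (simp_all add: norm_eq_1 inner_commute)
  have vv: "v \<bullet> v = 1" "a \<bullet> v = 0" "u \<bullet> v = 0" "v \<bullet> a = 0" "v \<bullet> u = 0"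
    using aa assms(3) by (simp_all add: v_def dot_cross dot_cross_self)
  have "a \<bullet> d = 0" "u \<bullet> d = 0" "v \<bullet> d = 0"
    using aa vv assms(3) by (simp_all add: d_def inner_diff_right inner_add_right)
  then have "d \<bullet> v = 0 \<and> d \<times> v = 0" by (simp add: v_def Lagrange inner_commute)
  then have "d = 0 \<or> v = 0" by (simp only: norm_and_cross_eq_0)
  moreover have "v \<noteq> 0" using vv by auto
  ultimately show ?thesis by (simp add: d_def v_def)
qed

text \<open>The components of \<open>y\<close> and \<open>z\<close> orthogonal to the axis have
  equal length \<open>r\<close>. In the frame \<open>u\<close>, \<open>v\<close> of that plane with
  \<open>u\<close> along the component of \<open>y\<close>, the coordinates of the other one divided
  by \<open>r\<close> are a cosine and a sine.\<close>

lemma rotation_about_transitive_on_circle: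
  assumes "norm a = 1" "norm y = norm z" "a \<bullet> y = a \<bullet> z"
  obtains t where "rotation_about a t y = z"
proof -
  define y' z' where "y' = y - (a \<bullet> y) *\<^sub>R a" and "z' = z - (a \<bullet> z) *\<^sub>R a"
  have aa: "a \<bullet> a = 1" using assms by (simp add: norm_eq_1)
  have yz: "y' \<bullet> y' = z' \<bullet> z'"
  proof -
    have "y \<bullet> y = z \<bullet> z" using assms(2) by (simp add: norm_eq)
    then show ?thesis
      using aa assms(3) by (simp add: y'_def z'_def inner_diff_left inner_diff_right inner_commute)
  qed
  show ?thesis
  proof (cases "y' = 0")
    case True
    then have "z' = 0" using yz by simp
    then have "y = z" using True assms(3) by (simp add: y'_def z'_def)
    then show ?thesis using that[of 0] by simp
  next
    case False
    define r where "r = norm y'"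
    define u where "u = (1 / r) *\<^sub>R y'"
    have r: "r > 0" "r * r = z' \<bullet> z'" using False yz
      by (simp_all add: r_def power2_norm_eq_inner flip: power2_eq_square)
    have ort: "a \<bullet> y' = 0" "a \<bullet> z' = 0"
      using aa by (simp_all add: y'_def z'_def inner_diff_right)
    have u: "norm u = 1" "a \<bullet> u = 0" "y' = r *\<^sub>R u"
      using r ort by (simp_all add: u_def r_def)
    have uu: "u \<bullet> u = 1" using u by (simp add: norm_eq_1)
    define v where "v = a \<times> u"
    have vv: "v \<bullet> v = 1" "u \<bullet> v = 0" "v \<bullet> u = 0"
      using uu aa u by (simp_all add: v_def dot_cross dot_cross_self inner_commute)
    have z': "z' = (u \<bullet> z') *\<^sub>R u + (v \<bullet> z') *\<^sub>R v"
      using orthonormal_expansion_cross[OF assms(1) u(1,2), of z'] ort by (simp add: v_def)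
    have "z' \<bullet> z' = ((u \<bullet> z') *\<^sub>R u + (v \<bullet> z') *\<^sub>R v) \<bullet> ((u \<bullet> z') *\<^sub>R u + (v \<bullet> z') *\<^sub>R v)"
      using z' by simp
    also have "\<dots> = (u \<bullet> z')\<^sup>2 + (v \<bullet> z')\<^sup>2"
      using uu vv by (simp add: inner_add_left inner_add_right power2_eq_square)
    finally have "(u \<bullet> z')\<^sup>2 + (v \<bullet> z')\<^sup>2 = r\<^sup>2" using r(2) by (simp add: power2_eq_square)
    then have "((u \<bullet> z') / r)\<^sup>2 + ((v \<bullet> z') / r)\<^sup>2 = 1"
      using r by (simp add: power_divide flip: add_divide_distrib)
    then obtain t where t: "(u \<bullet> z') / r = cos t" "(v \<bullet> z') / r = sin t"
      by (metis sincos_total_2pi)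
    have "a \<times> y = r *\<^sub>R v"
    proof -
      have "a \<times> y' = a \<times> y" by (simp add: y'_def Cross3.right_diff_distrib cross_mult_right)
      then show ?thesis by (simp add: u(3) v_def cross_mult_right)
    qed
    then have "rotation_about a t y = (a \<bullet> y) *\<^sub>R a + (cos t * r) *\<^sub>R u + (sin t * r) *\<^sub>R v"
      using u(3) by (simp add: rotation_about_def flip: y'_def)
    also have "\<dots> = (a \<bullet> z) *\<^sub>R a + z'"
      using t r assms(3) by (subst z') (simp add: field_simps)
    finally show ?thesis using that[of t] by (simp add: z'_def)
  qed
qed

section \<open>Euler's theorem on rotations\<close>

text \<open>With \<open>?A\<close> orthogonal of determinant 1, factoring \<open>?A - mat 1\<close>
  as \<open>?A ** (mat 1 - transpose ?A)\<close> shows that it has the determinant of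
  \<open>mat 1 - ?A\<close>.\<close>

lemma rotation_fixed_vector:
  fixes h :: "real^3 \<Rightarrow> real^3"
  assumes "orthogonal_transformation h" "det (matrix h) = 1"
  obtains a where "norm a = 1" "h a = a"
proof -
  let ?A = "matrix h"
  have hA: "h x = ?A *v x" for x
    using orthogonal_transformation_linear[OF assms(1)] by (simp add: matrix_vector_mul)
  have AA: "?A ** transpose ?A = mat 1"
    using assms(1) unfolding orthogonal_transformation_matrix orthogonal_matrix_def by simp
  have "A ** (mat 1 - B) = A - A ** B" for A B :: "real^3^3"
    using matrix_mul_rid[of A]
    by (simp add: matrix_matrix_mult_def vec_eq_iff right_diff_distrib sum_subtractf)
  from this[of ?A "transpose ?A"] have "?A - mat 1 = ?A ** (mat 1 - transpose ?A)"
    by (simp add: AA)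
  moreover have "mat 1 - transpose ?A = transpose (mat 1 - ?A)"
    by (simp add: transpose_def vec_eq_iff mat_def eq_commute)
  ultimately have "det (?A - mat 1) = det (transpose (mat 1 - ?A))"
    using assms(2) by (simp add: det_mul)
  also have "\<dots> = det (mat 1 - ?A)" by (rule det_transpose)
  \<comment> \<open>The sign comes from the odd dimension; a number equal to its own negative is
    0.\<close>
  also have "\<dots> = - det (?A - mat 1)" by (simp add: det_3 algebra_simps)
  finally have "det (?A - mat 1) = 0" by simp
  then obtain x where x: "x \<noteq> 0" "(?A - mat 1) *v x = 0"
    using invertible_det_nz matrix_left_invertible_ker invertible_left_inverse by metis
  then have "h x = x" by (simp add: hA matrix_vector_mult_diff_rdistrib)
  then have "h ((1 / norm x) *\<^sub>R x) = (1 / norm x) *\<^sub>R x"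
    using assms(1) by (simp add: orthogonal_transformation_scaleR)
  then show ?thesis using that[of "(1 / norm x) *\<^sub>R x"] x by simp
qed

lemma rotation_about_minus_axis: "rotation_about (- a) t x = rotation_about a (- t) x"
  by (simp add: rotation_about_def)

text \<open>In the frame \<open>a\<close>, \<open>u\<close>, \<open>a \<times> u\<close> the image
  of \<open>u\<close> is given by \<open>c\<close> and \<open>s\<close>, and determinant 1 makes
  \<open>h\<close> respect cross products, which fixes the image of the third vector. The range up
  to \<open>pi\<close> is wanted because there the cosine determines the angle; it is reached by
  reversing the axis if \<open>s\<close> is negative.\<close>

lemma rotation_eq_rotation_about:
  fixes h :: "real^3 \<Rightarrow> real^3"
  assumes "orthogonal_transformation h" "det (matrix h) = 1"
  obtains a t where "norm a = 1" "0 \<le> t" "t \<le> pi" "h = rotation_about a t"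
proof -
  have lin: "linear h" using assms(1) by (rule orthogonal_transformation_linear)
  have inn: "h x \<bullet> h y = x \<bullet> y" for x y using assms(1) by (simp add: orthogonal_transformation_def)
  obtain a where a: "norm a = 1" "h a = a" using rotation_fixed_vector[OF assms] .
  obtain u0 where u0: "u0 \<noteq> 0" "a \<bullet> u0 = 0"
    using orthogonal_to_vector_exists[of a] unfolding orthogonal_def by auto
  define u where "u = (1 / norm u0) *\<^sub>R u0"
  have u: "norm u = 1" "a \<bullet> u = 0" using u0 by (simp_all add: u_def)
  define v where "v = a \<times> u"
  have aa: "a \<bullet> a = 1" "u \<bullet> u = 1" using a u by (simp_all add: norm_eq_1)
  have vv: "v \<bullet> v = 1" "u \<bullet> v = 0" "v \<bullet> u = 0" "a \<bullet> v = 0"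
    using aa u by (simp_all add: v_def dot_cross dot_cross_self inner_commute)
  have av: "a \<times> v = - u" using aa u by (simp add: v_def Lagrange)
  define c s where "c = u \<bullet> h u" and "s = v \<bullet> h u"
  have "a \<bullet> h u = 0" using inn[of a u] a u by simp
  then have hu: "h u = c *\<^sub>R u + s *\<^sub>R v"
    using orthonormal_expansion_cross[OF a(1) u, of "h u"] by (simp add: c_def s_def v_def)
  have "h u \<bullet> h u = 1" using inn aa by simp
  then have cs: "c\<^sup>2 + s\<^sup>2 = 1"
    using aa vv by (simp add: hu inner_add_left inner_add_right power2_eq_square)
  have "h v = h a \<times> h u"
    using cross_orthogonal_transformation[OF assms(1), of a u] assms(2) by (simp add: v_def)
  then have hv: "h v = c *\<^sub>R v - s *\<^sub>R u"
    using av by (simp add: a hu cross_add_right cross_mult_right flip: v_def)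
  have rot: "h = rotation_about a t" if t: "c = cos t" "s = sin t" for t
  proof
    fix w
    define \<alpha> \<beta> \<gamma> where "\<alpha> = a \<bullet> w" and "\<beta> = u \<bullet> w" and "\<gamma> = v \<bullet> w"
    have w: "w = \<alpha> *\<^sub>R a + \<beta> *\<^sub>R u + \<gamma> *\<^sub>R v"
      using orthonormal_expansion_cross[OF a(1) u, of w] by (simp add: \<alpha>_def \<beta>_def \<gamma>_def v_def)
    have "h w = \<alpha> *\<^sub>R a + \<beta> *\<^sub>R (c *\<^sub>R u + s *\<^sub>R v) + \<gamma> *\<^sub>R (c *\<^sub>R v - s *\<^sub>R u)"
      by (subst w) (simp add: linear_add[OF lin] linear_cmul[OF lin] a hu hv)
    also have "\<dots> = \<alpha> *\<^sub>R a + c *\<^sub>R (w - \<alpha> *\<^sub>R a) + s *\<^sub>R (a \<times> w)"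
      by (simp add: w cross_add_right cross_mult_right av algebra_simps flip: v_def)
    finally show "h w = rotation_about a t w" by (simp add: rotation_about_def t \<alpha>_def)
  qed
  show ?thesis
  proof (cases "0 \<le> s")
    case True
    then obtain t where "0 \<le> t" "t \<le> pi" "c = cos t" "s = sin t"
      using sincos_total_pi[OF _ cs] by blast
    then show ?thesis using that[OF a(1)] rot by blast
  next
    case False
    then obtain t where t: "0 \<le> t" "t \<le> pi" "c = cos t" "- s = sin t"
      using sincos_total_pi[of "- s" c] cs by auto
    have "h = rotation_about a (- t)" using t by (intro rot) (simp_all flip: t(4))
    then have "h = rotation_about (- a) t" by (simp add: rotation_about_minus_axis[abs_def] fun_eq_iff)
    then show ?thesis using that[of "- a" t] a(1) t by simp
  qed
qed

section \<open>A full circle of rotations from infinitely many symmetries\<close>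

text \<open>Bolzano-Weierstrass: the images of the three basis vectors determine a linear map and
  are bounded for orthogonal ones, so infinitely many maps have a limit point in matrix
  space.\<close>

lemma small_orthogonal_difference:
  fixes Z :: "(real^3 \<Rightarrow> real^3) set"
  assumes "infinite Z" and Z: "\<And>f. f \<in> Z \<Longrightarrow> orthogonal_transformation f" and "0 < e"
  obtains f g where "f \<in> Z" "g \<in> Z" "f \<noteq> g" "\<And>x. norm (f x - g x) \<le> e * norm x"
proof -
  define \<phi> :: "(real^3 \<Rightarrow> real^3) \<Rightarrow> real^3^3" where "\<phi> f = (\<chi> i. f (axis i 1))" for f
  have expand: "f x = (\<Sum>i\<in>UNIV. x $ i *\<^sub>R (\<phi> f $ i))" if "linear f" for f x
  proof -
    have "f x = f (\<Sum>i\<in>UNIV. x $ i *\<^sub>R axis i 1)"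
      using basis_expansion[of x] by (simp add: scalar_mult_eq_scaleR)
    then show ?thesis using that by (simp add: linear_sum linear_cmul \<phi>_def)
  qed
  have lin: "linear f" if "f \<in> Z" for f using Z[OF that] by (rule orthogonal_transformation_linear)
  have "inj_on \<phi> Z"
  proof (rule inj_onI)
    fix f g assume "f \<in> Z" "g \<in> Z" "\<phi> f = \<phi> g"
    then show "f = g" using expand[OF lin, of f] expand[OF lin, of g] by (intro ext) metis
  qed
  then have "infinite (\<phi> ` Z)" using assms(1) finite_image_iff by blast
  moreover have "bounded (\<phi> ` Z)"
  proof -
    have "norm (\<phi> f) \<le> 3" if "f \<in> Z" for f
    proof -
      have "norm (\<phi> f) \<le> (\<Sum>i\<in>UNIV. norm (\<phi> f $ i))"
        unfolding norm_vec_def by (intro L2_set_le_sum) auto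
      also have "\<dots> = 3" using Z[OF that] by (simp add: \<phi>_def orthogonal_transformation_norm)
      finally show ?thesis .
    qed
    then show ?thesis by (auto simp: bounded_iff)
  qed
  ultimately obtain l where "l islimpt \<phi> ` Z" using bounded_infinite_imp_islimpt by blast
  \<comment> \<open>Two matrices in this ball are at distance at most \<open>e / 3\<close>; the
    estimate of \<open>f x - g x\<close> adds three coordinates, which gives
    \<open>e\<close>.\<close>
  then have "infinite (\<phi> ` Z \<inter> ball l (e / 6))"
    using assms(3) by (simp add: islimpt_eq_infinite_ball)
  then obtain p q where pq: "p \<in> \<phi> ` Z \<inter> ball l (e / 6)" "q \<in> \<phi> ` Z \<inter> ball l (e / 6)" "p \<noteq> q"
    by (metis finite.emptyI finite.insertI infinite_arbitrarily_large card_2_iff' finite_subset subsetI insertI1 singletonI)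
  then obtain f g where fg: "f \<in> Z" "g \<in> Z" "p = \<phi> f" "q = \<phi> g" by blast
  have "dist p q \<le> e / 3"
    using pq dist_triangle_half_r[of l p "e / 3" q] by (auto simp: mem_ball)
  then have d: "norm (\<phi> f $ i - \<phi> g $ i) \<le> e / 3" for i
    using Finite_Cartesian_Product.norm_nth_le[of "\<phi> f - \<phi> g" i] fg by (simp add: dist_norm)
  have "norm (f x - g x) \<le> e * norm x" for x
  proof -
    have "f x - g x = (\<Sum>i\<in>UNIV. x $ i *\<^sub>R (\<phi> f $ i - \<phi> g $ i))"
      using expand[OF lin] fg by (simp add: scaleR_diff_right sum_subtractf)
    also have "norm \<dots> \<le> (\<Sum>i\<in>UNIV. norm (x $ i *\<^sub>R (\<phi> f $ i - \<phi> g $ i)))" by (rule norm_sum)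
    also have "\<dots> \<le> (\<Sum>i\<in>(UNIV :: 3 set). norm x * (e / 3))"
    proof (rule sum_mono)
      fix i :: 3
      show "norm (x $ i *\<^sub>R (\<phi> f $ i - \<phi> g $ i)) \<le> norm x * (e / 3)"
        unfolding norm_scaleR real_norm_def by (intro mult_mono d component_le_norm_cart) auto
    qed
    also have "\<dots> = e * norm x" by simp
    finally show ?thesis .
  qed
  then show ?thesis using that fg pq by blast
qed

definition orthogonal_symmetries :: "(real^3) set \<Rightarrow> (real^3 \<Rightarrow> real^3) set" where
  "orthogonal_symmetries S = {f. orthogonal_transformation f \<and> f ` S = S}"

lemma orthogonal_symmetries_comp:
  "f \<in> orthogonal_symmetries S \<Longrightarrow> g \<in> orthogonal_symmetries S \<Longrightarrow> f \<circ> g \<in> orthogonal_symmetries S"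
  by (auto simp only: orthogonal_symmetries_def mem_Collect_eq image_comp[symmetric]
      intro: orthogonal_transformation_compose)

lemma orthogonal_symmetries_inv:
  assumes "f \<in> orthogonal_symmetries S"
  shows "inv_into UNIV f \<in> orthogonal_symmetries S"
proof -
  have "inj f" "f ` S = S"
    using assms by (auto simp: orthogonal_symmetries_def orthogonal_transformation_inj)
  then have "inv_into UNIV f ` S = S" by (metis image_inv_f_f)
  then show ?thesis
    using assms by (simp add: orthogonal_symmetries_def orthogonal_transformation_inv)
qed

text \<open>The quotient \<open>h\<close> of two close symmetries is near the identity. Its square
  is a rotation, still near the identity, whose angle is read off from a vector orthogonal to its
  axis.\<close>

lemma small_rotation_symmetry:
  assumes inf: "infinite (orthogonal_symmetries S)" and "0 < d"
  obtains a t where "norm a = 1" "0 < t" "t < d" "rotation_about a t \<in> orthogonal_symmetries S"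
proof -
  define d' where "d' = min d pi"
  have d': "0 < d'" "d' \<le> pi" "d' \<le> d" using assms(2) pi_gt_zero by (auto simp: d'_def)
  have "cos d' < cos 0" using d' by (intro cos_monotone_0_pi) auto
  \<comment> \<open>The angle \<open>t\<close> found below satisfies
    \<open>1 - cos t \<le> 2 * e\<close>, which is half of \<open>1 - cos d'\<close>; as
    \<open>d' \<le> pi\<close>, this forces \<open>t < d'\<close>.\<close>
  define e where "e = (1 - cos d') / 4"
  have e: "0 < e" using \<open>cos d' < cos 0\<close> by (simp add: e_def)
  have "(1 - y) / 4 \<le> 1 / 2" if "- 1 \<le> y" for y :: real using that by simp
  from this[OF cos_ge_minus_one[of d']] have e_half: "e \<le> 1 / 2" unfolding e_def .
  obtain f g where fg: "f \<in> orthogonal_symmetries S" "g \<in> orthogonal_symmetries S" "f \<noteq> g"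
      and d: "\<And>x. norm (f x - g x) \<le> e * norm x"
    using small_orthogonal_difference[OF inf _ e] by (auto simp: orthogonal_symmetries_def)
  define h where "h = inv_into UNIV g \<circ> f"
  have orth: "orthogonal_transformation f" "orthogonal_transformation g"
    using fg by (auto simp: orthogonal_symmetries_def)
  have h: "h \<in> orthogonal_symmetries S"
    unfolding h_def using fg by (intro orthogonal_symmetries_comp orthogonal_symmetries_inv)
  then have oh: "orthogonal_transformation h" by (simp add: orthogonal_symmetries_def)
  have gh: "g (h x) = f x" for x
    using orthogonal_transformation_surj[OF orth(2)] by (simp add: h_def surj_f_inv_f)
  have small: "norm (h x - x) \<le> e * norm x" for x
  proof -
    have "norm (h x - x) = norm (g (h x - x))" using orth(2) by (simp add: orthogonal_transformation_norm)
    also have "g (h x - x) = f x - g x"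
      using orthogonal_transformation_linear[OF orth(2)] gh by (simp add: linear_diff)
    finally show ?thesis using d by simp
  qed
  \<comment> \<open>Squaring makes the determinant 1. That the square is not the identity needs an
    argument, given below.\<close>
  define k where "k = h \<circ> h"
  have k: "k \<in> orthogonal_symmetries S" unfolding k_def using h by (intro orthogonal_symmetries_comp)
  then have ok: "orthogonal_transformation k" by (simp add: orthogonal_symmetries_def)
  have "det (matrix k) = det (matrix h) * det (matrix h)"
    unfolding k_def using orthogonal_transformation_linear[OF oh]
    by (simp add: matrix_compose det_mul)
  also have "\<dots> = \<bar>det (matrix h)\<bar> * \<bar>det (matrix h)\<bar>" by simp
  also have "\<dots> = 1" using orthogonal_transformation_det[OF oh] by simp
  finally obtain a t where at: "norm a = 1" "0 \<le> t" "t \<le> pi" "k = rotation_about a t"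
    using rotation_eq_rotation_about[OF ok] by blast
  have "t \<noteq> 0"
  proof
    assume "t = 0"
    then have kid: "h (h x) = x" for x using at(4) by (metis comp_apply k_def rotation_about_0)
    have "h x = x" for x
    proof -
      \<comment> \<open>An involution negates \<open>h x - x\<close> and so moves it by twice its
        norm, whereas \<open>h\<close> moves it by at most half of its norm.\<close>
      have "h (h x - x) = - (h x - x)"
        using orthogonal_transformation_linear[OF oh] kid by (simp add: linear_diff)
      then have "norm (- (h x - x) - (h x - x)) \<le> e * norm (h x - x)"
        using small[of "h x - x"] by simp
      moreover have "- (h x - x) - (h x - x) = (-2) *\<^sub>R (h x - x)" by (simp add: scaleR_2)
      ultimately have "2 * norm (h x - x) \<le> e * norm (h x - x)" by (metis norm_scaleR abs_neg_numeral)
      moreover have "e * norm (h x - x) \<le> 1 * norm (h x - x)" using e_half by (intro mult_right_mono) auto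
      ultimately have "norm (h x - x) \<le> 0" by linarith
      then show "h x = x" by simp
    qed
    then have "f = g" using gh by (metis ext)
    then show False using fg by simp
  qed
  obtain u0 where u0: "u0 \<noteq> 0" "a \<bullet> u0 = 0"
    using orthogonal_to_vector_exists[of a] unfolding orthogonal_def by auto
  have "norm (k u0 - u0) \<le> 2 * e * norm u0"
  proof -
    have "norm (k u0 - u0) \<le> norm (h (h u0) - h u0) + norm (h u0 - u0)"
      using norm_triangle_ineq[of "h (h u0) - h u0" "h u0 - u0"] by (simp add: k_def)
    also have "\<dots> \<le> e * norm (h u0) + e * norm u0" by (intro add_mono small)
    finally show ?thesis using oh by (simp add: orthogonal_transformation_norm)
  qed
  moreover have "(1 - cos t) * norm u0 \<le> norm (k u0 - u0)"
  proof -
    have "u0 \<bullet> (u0 - k u0) = (1 - cos t) * (norm u0 * norm u0)"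
      using u0 by (simp add: at(4) rotation_about_def inner_diff_right inner_add_right dot_cross_self
          algebra_simps flip: power2_eq_square power2_norm_eq_inner)
    moreover have "u0 \<bullet> (u0 - k u0) \<le> norm u0 * norm (u0 - k u0)" by (rule norm_cauchy_schwarz)
    ultimately have "(1 - cos t) * norm u0 * norm u0 \<le> norm (k u0 - u0) * norm u0"
      by (simp add: norm_minus_commute mult.commute mult.left_commute)
    then show ?thesis using u0 by (simp add: mult_le_cancel_right)
  qed
  ultimately have "(1 - cos t) * norm u0 \<le> 2 * e * norm u0" by linarith
  then have "1 - cos t \<le> 2 * e" using u0 by simp
  then have "cos d' < cos t" using e by (simp add: e_def)
  then have "t < d'"
    using cos_monotone_0_pi_le[of d' t] d' at by (cases "t < d'") auto
  then have "t < d" "0 < t" using d' at(2) \<open>t \<noteq> 0\<close> by auto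
  moreover have "rotation_about a t \<in> orthogonal_symmetries S" using k by (simp add: at(4))
  ultimately show ?thesis using that[OF at(1)] by blast
qed

text \<open>By compactness of the sphere the axes of rotations with angles tending to 0 converge
  along a subsequence. Suitable powers have angles tending to a prescribed \<open>t\<close>, and the
  limits of the images of a point stay in the closed set \<open>S\<close>.\<close>

lemma rotation_axis_of_infinite_symmetries:
  assumes "compact S" and inf: "infinite (orthogonal_symmetries S)"
  obtains a where "norm a = 1" "\<And>t. rotation_about a t \<in> orthogonal_symmetries S"
proof -
  have "\<exists>a t. norm a = 1 \<and> 0 < t \<and> t < inverse (real (Suc n)) \<and>
      rotation_about a t \<in> orthogonal_symmetries S" for n
    by (rule small_rotation_symmetry[OF inf, of "inverse (real (Suc n))"]) auto
  then obtain a \<theta> where a: "\<And>n. norm (a n) = 1" and \<theta>: "\<And>n. 0 < \<theta> n" "\<And>n. \<theta> n < inverse (real (Suc n))"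
    and rot: "\<And>n. rotation_about (a n) (\<theta> n) \<in> orthogonal_symmetries S"
    by metis
  have "\<forall>n. a n \<in> sphere 0 1" using a by simp
  then obtain l r where l: "l \<in> sphere 0 1" and r: "strict_mono (r :: nat \<Rightarrow> nat)" and lim: "(a \<circ> r) \<longlonglongrightarrow> l"
    using compact_sphere[of "0 :: real^3" 1] unfolding compact_def by metis
  have "\<theta> \<longlonglongrightarrow> 0"
    using \<theta> by (intro tendsto_sandwich[OF _ _ tendsto_const LIMSEQ_inverse_real_of_nat])
      (auto intro: always_eventually less_imp_le)
  then have \<theta>0: "(\<lambda>n. \<theta> (r n)) \<longlonglongrightarrow> 0"
    using LIMSEQ_subseq_LIMSEQ[OF _ r] by (force simp: o_def)
  have pos: "rotation_about l t x \<in> S" if "0 \<le> t" "x \<in> S" for t x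
  proof -
    \<comment> \<open>The number of steps of size \<open>\<theta> (r n)\<close> that fit into
      \<open>t\<close>; the accumulated angle misses \<open>t\<close> by at most one step.\<close>
    define k where "k n = nat \<lfloor>t / \<theta> (r n)\<rfloor>" for n
    have k: "real (k n) * \<theta> (r n) \<le> t" "t - \<theta> (r n) \<le> real (k n) * \<theta> (r n)" for n
    proof -
      have "0 \<le> t / \<theta> (r n)" using that \<theta>(1)[of "r n"] by simp
      then have "real (k n) \<le> t / \<theta> (r n)" "t / \<theta> (r n) - 1 \<le> real (k n)"
        unfolding k_def by linarith+
      then show "real (k n) * \<theta> (r n) \<le> t" "t - \<theta> (r n) \<le> real (k n) * \<theta> (r n)"
        using \<theta>(1)[of "r n"] by (simp_all add: field_simps)
    qed
    have "(\<lambda>n. t - \<theta> (r n)) \<longlonglongrightarrow> t" using tendsto_diff[OF tendsto_const \<theta>0] by simp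
    then have "(\<lambda>n. real (k n) * \<theta> (r n)) \<longlonglongrightarrow> t"
      by (rule tendsto_sandwich[rotated 2]) (use k in \<open>auto intro: always_eventually\<close>)
    then have lim': "(\<lambda>n. rotation_about (a (r n)) (real (k n) * \<theta> (r n)) x) \<longlonglongrightarrow> rotation_about l t x"
      using lim by (intro tendsto_rotation_about) (simp_all add: o_def)
    have "rotation_about (a (r n)) (real (k n) * \<theta> (r n)) x \<in> S" for n
    proof -
      have "(rotation_about (a (r n)) (\<theta> (r n)) ^^ m) x \<in> S" for m
        using that rot[of "r n"] by (induction m) (auto simp: orthogonal_symmetries_def)
      then show ?thesis by (simp add: rotation_about_funpow[OF a])
    qed
    then show ?thesis
      using lim' by (rule closed_sequentially[OF compact_imp_closed[OF assms(1)]])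
  qed
  \<comment> \<open>Powers reach only nonnegative angles; a negative angle is made nonnegative by
    adding full turns.\<close>
  have all: "rotation_about l t x \<in> S" if "x \<in> S" for t x
  proof -
    obtain m :: nat where "- t / (2 * pi) \<le> real m" using real_arch_simple by blast
    then have "0 \<le> t + 2 * pi * real m" by (simp add: field_simps)
    from pos[OF this that] show ?thesis by (simp add: rotation_about_periodic)
  qed
  have nl: "norm l = 1" using l by simp
  have "rotation_about l t ` S = S" for t
  proof
    show "rotation_about l t ` S \<subseteq> S" using all by auto
    show "S \<subseteq> rotation_about l t ` S"
    proof
      fix x assume "x \<in> S"
      moreover have "x = rotation_about l t (rotation_about l (- t) x)"
        by (simp add: rotation_about_add[OF nl])
      ultimately show "x \<in> rotation_about l t ` S" using all by blast
    qed
  qed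
  then show ?thesis
    using that[OF nl] orthogonal_rotation_about[OF nl] by (simp add: orthogonal_symmetries_def)
qed

text \<open>Conjugation by \<open>f\<close> moves the axis to \<open>f a\<close>. A map of
  determinant -1 reverses cross products and with them the sense of rotation, so the conjugated
  angle is \<open>\<delta> * t\<close>; all angles being available, the sign does no harm.\<close>

lemma rotation_symmetries_conj:
  assumes "f \<in> orthogonal_symmetries S" "\<And>t. rotation_about a t \<in> orthogonal_symmetries S"
  shows "rotation_about (f a) t \<in> orthogonal_symmetries S"
proof -
  have o: "orthogonal_transformation f" using assms(1) by (simp add: orthogonal_symmetries_def)
  have lin: "linear f" using o by (rule orthogonal_transformation_linear)
  define \<delta> where "\<delta> = det (matrix f)"
  have \<delta>: "\<delta> = 1 \<or> \<delta> = - 1" using orthogonal_transformation_det[OF o] by (auto simp: \<delta>_def)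
  have cr: "f (a \<times> y) = \<delta> *\<^sub>R (f a \<times> f y)" for y
    using cross_orthogonal_transformation[OF o, of a y] \<delta> by (auto simp flip: \<delta>_def)
  have "f (rotation_about a (\<delta> * t) y) = rotation_about (f a) t (f y)" for y
    using \<delta> o cr by (auto simp: rotation_about_def linear_add[OF lin] linear_diff[OF lin]
        linear_cmul[OF lin] orthogonal_transformation_def)
  then have "f (rotation_about a (\<delta> * t) (inv_into UNIV f y)) = rotation_about (f a) t y" for y
    using orthogonal_transformation_surj[OF o] by (simp add: surj_f_inv_f)
  then have "rotation_about (f a) t = f \<circ> (rotation_about a (\<delta> * t) \<circ> inv_into UNIV f)"
    by (simp add: fun_eq_iff)
  then show ?thesis
    using assms by (simp add: orthogonal_symmetries_comp orthogonal_symmetries_inv)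
qed

section \<open>Convex bodies with infinitely many symmetries\<close>

lemma norm_cross_less:
  fixes a b :: "real^3"
  assumes "norm a = 1" "norm b = 1" "a \<times> b \<noteq> 0"
  shows "(a \<bullet> b)\<^sup>2 < 1"
proof -
  have "0 < (norm (a \<times> b))\<^sup>2" using assms(3) by simp
  moreover have "(norm (a \<times> b))\<^sup>2 + (a \<bullet> b)\<^sup>2 = 1"
    using norm_cross_dot[of a b] assms(1,2) by simp
  ultimately show ?thesis by linarith
qed

text \<open>A point of \<open>K\<close> of greatest height along \<open>a\<close> must be the pole.
  At any other height, a rotation about \<open>a\<close> brings it to a place on its circle of
  latitude from which a rotation about \<open>b\<close> lifts it further; the opposite pole is
  lifted by a half-turn about \<open>b\<close>.\<close>

lemma pole_in_rotation_invariant_set: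
  assumes ab: "norm a = 1" "norm b = 1" "a \<times> b \<noteq> 0"
    and K: "compact K" "K \<noteq> {}" "K \<subseteq> sphere 0 r" and "0 < r"
    and inv: "\<And>t y. y \<in> K \<Longrightarrow> rotation_about a t y \<in> K" "\<And>t y. y \<in> K \<Longrightarrow> rotation_about b t y \<in> K"
  shows "r *\<^sub>R a \<in> K"
proof -
  have "continuous_on K (\<lambda>y. a \<bullet> y)" by (intro continuous_intros)
  then obtain y where y: "y \<in> K" and max: "\<And>z. z \<in> K \<Longrightarrow> a \<bullet> z \<le> a \<bullet> y"
    using continuous_attains_sup[OF K(1,2)] by blast
  define m where "m = a \<bullet> y"
  have ny: "norm y = r" using y K(3) by auto
  have aa: "a \<bullet> a = 1" using ab by (simp add: norm_eq_1)
  have yy: "y \<bullet> y = r\<^sup>2" using ny by (simp add: power2_norm_eq_inner[symmetric])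
  have less1: "(a \<bullet> b)\<^sup>2 < 1" by (rule norm_cross_less[OF ab])
  have abs_m: "\<bar>m\<bar> \<le> r"
    using Cauchy_Schwarz_ineq2[of a y] ab ny by (simp add: m_def)
  have "m = r"
  proof (rule ccontr)
    assume "m \<noteq> r"
    show False
    proof (cases "m = - r")
      case True
      have "(y + r *\<^sub>R a) \<bullet> (y + r *\<^sub>R a) = 0"
        using aa yy True by (simp add: m_def inner_add_left inner_add_right inner_commute power2_eq_square)
      then have yra: "y = - (r *\<^sub>R a)" by (simp add: eq_neg_iff_add_eq_0)
      have "a \<bullet> rotation_about b pi y \<le> - r"
        using max[OF inv(2)[OF y]] True by (simp add: m_def)
      moreover have "a \<bullet> rotation_about b pi y = r - 2 * r * (a \<bullet> b)\<^sup>2"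
      proof -
        have "a \<bullet> rotation_about b t y = (b \<bullet> y) * (a \<bullet> b)
            + cos t * (a \<bullet> y - (b \<bullet> y) * (a \<bullet> b)) + sin t * (a \<bullet> (b \<times> y))" for t
          by (simp add: rotation_about_def inner_add_right inner_diff_right)
        from this[of pi] have "a \<bullet> rotation_about b pi y
            = (b \<bullet> y) * (a \<bullet> b) - (a \<bullet> y - (b \<bullet> y) * (a \<bullet> b))" by simp
        also have "b \<bullet> y = - (r * (a \<bullet> b))" by (simp add: yra inner_commute)
        also have "a \<bullet> y = - r" using True by (simp add: m_def)
        finally show ?thesis by (simp add: power2_eq_square)
      qed
      ultimately have "r * (1 - (a \<bullet> b)\<^sup>2) \<le> 0" by (simp add: algebra_simps)
      then show False using less1 \<open>0 < r\<close> by (simp add: mult_le_0_iff)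
    next
      case False
      then have "\<bar>m\<bar> < r" using abs_m \<open>m \<noteq> r\<close> by auto
      then have "m\<^sup>2 < r\<^sup>2" using power_strict_mono[of "\<bar>m\<bar>" r 2] by simp
      define \<rho> where "\<rho> = sqrt (r\<^sup>2 - m\<^sup>2)"
      have \<rho>: "0 < \<rho>" "\<rho>\<^sup>2 = r\<^sup>2 - m\<^sup>2" using \<open>m\<^sup>2 < r\<^sup>2\<close> by (simp_all add: \<rho>_def)
      define n where "n = (1 / norm (a \<times> b)) *\<^sub>R (a \<times> b)"
      \<comment> \<open>On the latitude of \<open>y\<close>, in the direction of
        \<open>a \<times> b\<close>: there the initial rate of climb under rotation about
        \<open>b\<close>, the number \<open>C\<close> below, is positive.\<close>
      define z where "z = m *\<^sub>R a + \<rho> *\<^sub>R n"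
      have n: "norm n = 1" "a \<bullet> n = 0" using ab by (simp_all add: n_def dot_cross_self)
      have az: "a \<bullet> z = m" using n aa by (simp add: z_def inner_add_right)
      have "z \<bullet> z = m\<^sup>2 + \<rho>\<^sup>2"
        using n aa by (simp add: z_def inner_add_right inner_add_left norm_eq_1 inner_commute power2_eq_square)
      then have "norm z = norm y" using \<rho> yy by (simp add: norm_eq)
      then obtain t where "rotation_about a t y = z"
        using rotation_about_transitive_on_circle[OF ab(1), of y z] az by (auto simp: m_def)
      then have zK: "z \<in> K" using inv(1)[OF y] by auto
      \<comment> \<open>The height of the rotated \<open>z\<close> is
        \<open>(m - B) + cos s * B + sin s * C\<close>. Its largest value over all angles
        \<open>s\<close> is \<open>m - B + q\<close> with \<open>q\<close> below, which exceeds
        \<open>m\<close> since \<open>C\<close> is positive.\<close>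
      define B C where "B = m - (b \<bullet> z) * (a \<bullet> b)" and "C = a \<bullet> (b \<times> z)"
      have "C = z \<bullet> (a \<times> b)" using cross_triple[of a b z] by (simp add: C_def inner_commute)
      also have "\<dots> = \<rho> * norm (a \<times> b)"
        using ab by (simp add: z_def n_def inner_add_left dot_cross_self power2_eq_square[symmetric]
            power2_norm_eq_inner[symmetric]) (simp add: power2_eq_square)
      finally have C: "C > 0" using \<rho> ab by simp
      define q where "q = sqrt (B\<^sup>2 + C\<^sup>2)"
      have q: "q\<^sup>2 = B\<^sup>2 + C\<^sup>2" "q > 0" using C by (simp_all add: q_def add_nonneg_pos)
      have "(B / q)\<^sup>2 + (C / q)\<^sup>2 = (B\<^sup>2 + C\<^sup>2) / q\<^sup>2"
        by (simp add: power_divide add_divide_distrib)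
      also have "\<dots> = 1" using q(2) by (simp flip: q(1))
      finally have "(B / q)\<^sup>2 + (C / q)\<^sup>2 = 1" .
      then obtain s where s: "B / q = cos s" "C / q = sin s" by (metis sincos_total_2pi)
      have "cos s * B + sin s * C = (B\<^sup>2 + C\<^sup>2) / q"
        by (simp add: s[symmetric] power2_eq_square add_divide_distrib)
      also have "\<dots> = q" using q(2) by (simp flip: q(1)) (simp add: power2_eq_square)
      finally have "cos s * B + sin s * C = q" .
      moreover have "a \<bullet> rotation_about b s z = (m - B) + cos s * B + sin s * C"
        using az by (simp add: rotation_about_def inner_add_right inner_diff_right B_def C_def)
      ultimately have "m - B + q \<le> m" using max[OF inv(2)[OF zK], of s] by (simp add: m_def)
      then have "q \<le> B" by simp
      then have "q\<^sup>2 \<le> B\<^sup>2" using q by (intro power_mono) auto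
      then show False using q C by simp
    qed
  qed
  then have "(y - r *\<^sub>R a) \<bullet> (y - r *\<^sub>R a) = 0"
    using aa yy by (simp add: m_def inner_diff_left inner_diff_right inner_commute power2_eq_square)
  then show ?thesis using y by simp
qed

text \<open>The pole lemma is used twice: on the part of \<open>S\<close> on the sphere, to put the
  pole into \<open>S\<close>, and on the orbit closure of an arbitrary \<open>z\<close>, to bring
  \<open>z\<close> close to the pole. Inverse symmetries then carry the pole to points of
  \<open>S\<close> that converge to \<open>z\<close>.\<close>

lemma sphere_subset_of_two_rotation_axes:
  assumes ab: "norm a = 1" "norm b = 1" "a \<times> b \<noteq> 0"
    and rot: "\<And>t. rotation_about a t \<in> orthogonal_symmetries S"
      "\<And>t. rotation_about b t \<in> orthogonal_symmetries S"
    and S: "compact S" "x \<in> S" "norm x = r" "0 < r"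
  shows "sphere 0 r \<subseteq> S"
proof
  fix z assume z: "z \<in> sphere (0 :: real^3) r"
  have pole: "r *\<^sub>R a \<in> K" if "compact K" "K \<noteq> {}" "K \<subseteq> sphere 0 r"
    "\<And>c t y. \<lbrakk>c \<in> {a, b}; y \<in> K\<rbrakk> \<Longrightarrow> rotation_about c t y \<in> K" for K
    using that by (intro pole_in_rotation_invariant_set[OF ab _ _ _ S(4)]) auto
  have rot': "rotation_about c t \<in> orthogonal_symmetries S" if "c \<in> {a, b}" for c t
    using that rot by auto
  have ra: "r *\<^sub>R a \<in> S"
  proof -
    have "r *\<^sub>R a \<in> S \<inter> sphere 0 r"
    proof (rule pole)
      show "compact (S \<inter> sphere 0 r)" using S(1) by (simp add: compact_Int)
      show "S \<inter> sphere 0 r \<noteq> {}" using S by auto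
      fix c t y assume "c \<in> {a, b}" "y \<in> S \<inter> sphere 0 r"
      then show "rotation_about c t y \<in> S \<inter> sphere 0 r"
        using rot'[of c t] by (auto simp: orthogonal_symmetries_def orthogonal_transformation_norm)
    qed auto
    then show ?thesis by simp
  qed
  \<comment> \<open>The orbit itself is not known to be closed, so the pole lemma is applied to its
    closure; invariance passes to the closure by continuity.\<close>
  define Q where "Q = (\<lambda>f. f z) ` orthogonal_symmetries S"
  have id: "(\<lambda>x. x) \<in> orthogonal_symmetries S" by (simp add: orthogonal_symmetries_def)
  have "Q \<subseteq> sphere 0 r"
    using z by (auto simp: Q_def orthogonal_symmetries_def orthogonal_transformation_norm)
  then have cl: "closure Q \<subseteq> sphere 0 r" by (rule closure_minimal) simp
  have "r *\<^sub>R a \<in> closure Q"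
  proof (rule pole)
    show "compact (closure Q)"
      using cl bounded_subset[OF bounded_sphere] by (auto simp: compact_eq_bounded_closed)
    show "closure Q \<noteq> {}" using id by (auto simp: Q_def)
    fix c t y assume c: "c \<in> {a, b}" and y: "y \<in> closure Q"
    have "continuous_on (closure Q) (rotation_about c t)"
      using linear_rotation_about by (simp add: linear_continuous_on linear_conv_bounded_linear)
    moreover have "rotation_about c t ` Q \<subseteq> closure Q"
      using orthogonal_symmetries_comp[OF rot'[OF c]] closure_subset[of Q]
      by (fastforce simp: Q_def)
    ultimately show "rotation_about c t y \<in> closure Q"
      using image_closure_subset[of Q "rotation_about c t" "closure Q"] y by auto
  qed (rule cl)
  then obtain w where w: "\<And>n. w n \<in> Q" "w \<longlonglongrightarrow> r *\<^sub>R a"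
    unfolding closure_sequential by blast
  have "\<exists>f. f \<in> orthogonal_symmetries S \<and> w n = f z" for n using w(1)[of n] by (auto simp: Q_def)
  then obtain f where f: "\<And>n. f n \<in> orthogonal_symmetries S" "\<And>n. w n = f n z" by metis
  \<comment> \<open>Each \<open>f n\<close> is an isometry, so \<open>y n\<close> is as far from
    \<open>z\<close> as the pole is from \<open>w n\<close>.\<close>
  define y where "y n = inv_into UNIV (f n) (r *\<^sub>R a)" for n
  have yS: "y n \<in> S" for n
    using orthogonal_symmetries_inv[OF f(1)[of n]] ra by (auto simp: orthogonal_symmetries_def y_def)
  have "norm (y n - z) = norm (r *\<^sub>R a - w n)" for n
  proof -
    have o: "orthogonal_transformation (f n)" using f(1) by (simp add: orthogonal_symmetries_def)
    have "f n (y n - z) = r *\<^sub>R a - w n"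
      using orthogonal_transformation_linear[OF o] orthogonal_transformation_surj[OF o] f(2)
      by (simp add: linear_diff y_def surj_f_inv_f)
    then show ?thesis using orthogonal_transformation_norm[OF o] by metis
  qed
  moreover have "(\<lambda>n. norm (r *\<^sub>R a - w n)) \<longlonglongrightarrow> 0"
    using tendsto_norm[OF tendsto_diff[OF tendsto_const[of "r *\<^sub>R a"] w(2)]] by simp
  ultimately have "(\<lambda>n. norm (y n - z)) \<longlonglongrightarrow> 0" by simp
  then have "(\<lambda>n. y n - z) \<longlonglongrightarrow> 0" by (rule tendsto_norm_zero_cancel)
  then have "y \<longlonglongrightarrow> z" by (simp add: LIM_zero_iff)
  with yS show "z \<in> S" by (rule closed_sequentially[OF compact_imp_closed[OF S(1)]])
qed

lemma not_subset_hyperplane: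
  fixes S :: "'a::euclidean_space set"
  assumes "interior S \<noteq> {}" "u \<noteq> 0"
  shows "\<not> S \<subseteq> {x. u \<bullet> x = k}"
  using assms interior_mono[of S "{x. u \<bullet> x = k}"] interior_hyperplane[of u k] by auto

text \<open>A symmetric parametrization of the segment, in which solid figures are filled in from
  opposite boundary points; the weights are \<open>(k - c) / (2 * k)\<close> and
  \<open>(k + c) / (2 * k)\<close>.\<close>

lemma segment_memI:
  fixes p v :: "'a::real_vector"
  assumes "convex S" "p - k *\<^sub>R v \<in> S" "p + k *\<^sub>R v \<in> S" "\<bar>c\<bar> \<le> k"
  shows "p + c *\<^sub>R v \<in> S"
proof (cases "k = 0")
  case False
  then have k: "k > 0" using assms(4) by linarith
  have "((k - c) / (2 * k)) *\<^sub>R (p - k *\<^sub>R v) + ((k + c) / (2 * k)) *\<^sub>R (p + k *\<^sub>R v) \<in> S"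
    using assms k by (intro convexD) (auto simp: field_simps)
  also have "((k - c) / (2 * k)) *\<^sub>R (p - k *\<^sub>R v) + ((k + c) / (2 * k)) *\<^sub>R (p + k *\<^sub>R v)
      = ((k - c) / (2 * k) + (k + c) / (2 * k)) *\<^sub>R p + (((k + c) / (2 * k) - (k - c) / (2 * k)) * k) *\<^sub>R v"
    by (simp add: algebra_simps)
  also have "\<dots> = p + c *\<^sub>R v"
  proof -
    have "(k - c) / (2 * k) + (k + c) / (2 * k) = 1" "((k + c) / (2 * k) - (k - c) / (2 * k)) * k = c"
      using k by (simp_all add: field_simps)
    then show ?thesis by simp
  qed
  finally show ?thesis .
qed (use assms in auto)

text \<open>Symmetries preserve both the norm and the modulus of the height along \<open>a\<close>,
  so all extreme points lie on two circles. Nonempty interior excludes the degenerate cases, since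
  no hyperplane contains all extreme points.\<close>

lemma cylinder_of_rotation_axis:
  fixes S :: "(real^3) set"
  assumes S: "compact S" "convex S" "interior S \<noteq> {}" and a: "norm a = 1"
    and rot: "\<And>t. rotation_about a t \<in> orthogonal_symmetries S"
    and ax: "\<And>f. f \<in> orthogonal_symmetries S \<Longrightarrow> f a = a \<or> f a = - a"
    and tr: "\<And>x y. \<lbrakk>x extreme_point_of S; y extreme_point_of S\<rbrakk> \<Longrightarrow>
      \<exists>f\<in>orthogonal_symmetries S. f x = y"
  obtains h \<rho> where "0 < h" "0 < \<rho>" "S = {y. \<bar>a \<bullet> y\<bar> \<le> h \<and> norm (y - (a \<bullet> y) *\<^sub>R a) \<le> \<rho>}"
proof -
  define E where "E = {x. x extreme_point_of S}"
  have hull: "S = convex hull E" unfolding E_def by (rule Krein_Milman_Minkowski[OF S(1,2)])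
  then have "E \<noteq> {}" using S(3) by auto
  then obtain x where x: "x \<in> E" by blast
  have ES: "E \<subseteq> S" by (auto simp: E_def extreme_point_of_def)
  have aa: "a \<bullet> a = 1" using a by (simp add: norm_eq_1)
  have a0: "a \<noteq> 0" using a by auto
  define h where "h = \<bar>a \<bullet> x\<bar>"
  define r where "r = norm x"
  have E: "norm y = r" "\<bar>a \<bullet> y\<bar> = h" if yE: "y \<in> E" for y
  proof -
    obtain f where f: "f \<in> orthogonal_symmetries S" "f x = y"
      using tr[of x y] x yE unfolding E_def by blast
    then have o: "orthogonal_transformation f" by (simp add: orthogonal_symmetries_def)
    show "norm y = r" using o f by (auto simp: r_def orthogonal_transformation_norm)
    have "f a \<bullet> y = a \<bullet> x" using o f by (auto simp: orthogonal_transformation_def)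
    then show "\<bar>a \<bullet> y\<bar> = h" using ax[OF f(1)] by (auto simp: h_def)
  qed
  have E_hyperplane: False if "E \<subseteq> {y. u \<bullet> y = k}" "u \<noteq> 0" for u k
  proof -
    have "S \<subseteq> {y. u \<bullet> y = k}" unfolding hull using that(1) by (rule hull_minimal) (rule convex_hyperplane)
    then show False using not_subset_hyperplane[OF S(3) that(2)] by blast
  qed
  have "h \<noteq> 0"
  proof
    assume "h = 0"
    then have "E \<subseteq> {y. a \<bullet> y = 0}" using E by auto
    then show False using E_hyperplane a0 by blast
  qed
  then have h: "0 < h" by (simp add: h_def)
  \<comment> \<open>If the height \<open>h\<close> did not occur, all extreme points would lie at
    height \<open>- h\<close>, in a single plane.\<close>
  obtain y1 where y1: "y1 \<in> E" "a \<bullet> y1 = h"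
  proof -
    have "\<not> E \<subseteq> {y. a \<bullet> y = - h}" using E_hyperplane a0 by blast
    then obtain y1 where "y1 \<in> E" "a \<bullet> y1 \<noteq> - h" by auto
    then show ?thesis using that E(2)[of y1] by (auto simp: abs_if split: if_splits)
  qed
  obtain y2 where y2: "y2 \<in> E" "a \<bullet> y2 = - h"
  proof -
    have "\<not> E \<subseteq> {y. a \<bullet> y = h}" using E_hyperplane a0 by blast
    then obtain y2 where "y2 \<in> E" "a \<bullet> y2 \<noteq> h" by auto
    then show ?thesis using that E(2)[of y2] by (auto simp: abs_if split: if_splits)
  qed
  have circ: "y \<in> S" if y: "norm y = r" "\<bar>a \<bullet> y\<bar> = h" for y
  proof -
    obtain w where w: "w \<in> E" "a \<bullet> w = a \<bullet> y"
      using y y1 y2 by (metis abs_if minus_minus)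
    then obtain t where "rotation_about a t w = y"
      using rotation_about_transitive_on_circle[OF a, of w y] y E(1)[OF w(1)] by auto
    moreover have "w \<in> S" using w ES by auto
    ultimately show ?thesis using rot[of t] by (auto simp: orthogonal_symmetries_def)
  qed
  have perp: "norm (y - (a \<bullet> y) *\<^sub>R a) ^ 2 = norm y ^ 2 - (a \<bullet> y)\<^sup>2" for y
    unfolding power2_norm_eq_inner
    using aa by (simp add: inner_diff_left inner_diff_right inner_commute power2_eq_square)
  define \<rho> where "\<rho> = norm (x - (a \<bullet> x) *\<^sub>R a)"
  have \<rho>2: "\<rho>\<^sup>2 = r\<^sup>2 - h\<^sup>2" by (simp add: \<rho>_def perp r_def h_def)
  have E\<rho>: "norm (y - (a \<bullet> y) *\<^sub>R a) = \<rho>" if "y \<in> E" for y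
  proof -
    have "(a \<bullet> y)\<^sup>2 = h\<^sup>2" using E(2)[OF that] by (metis power2_abs)
    then have "norm (y - (a \<bullet> y) *\<^sub>R a) ^ 2 = \<rho>\<^sup>2" by (simp add: perp \<rho>2 E(1)[OF that])
    then show ?thesis by (rule power2_eq_imp_eq) (auto simp: \<rho>_def)
  qed
  obtain u where u: "u \<noteq> 0" "a \<bullet> u = 0"
    using orthogonal_to_vector_exists[of a] unfolding orthogonal_def by auto
  have "\<rho> \<noteq> 0"
  proof
    assume "\<rho> = 0"
    have "u \<bullet> y = 0" if "y \<in> E" for y
    proof -
      have "y = (a \<bullet> y) *\<^sub>R a" using E\<rho>[OF that] \<open>\<rho> = 0\<close> by simp
      then have "u \<bullet> y = (a \<bullet> y) * (u \<bullet> a)" by (metis inner_scaleR_right)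
      then show ?thesis using u by (simp add: inner_commute)
    qed
    then show False using E_hyperplane[of u 0] u by auto
  qed
  then have \<rho>: "0 < \<rho>" by (simp add: \<rho>_def)
  let ?C = "{y. \<bar>a \<bullet> y\<bar> \<le> h \<and> norm (y - (a \<bullet> y) *\<^sub>R a) \<le> \<rho>}"
  have "S \<subseteq> ?C"
  proof -
    define p where "p y = y - (a \<bullet> y) *\<^sub>R a" for y
    have linp: "linear p" by (auto intro!: linearI simp: p_def inner_add_right algebra_simps)
    have "convex ?C"
    proof -
      have "?C = (\<lambda>y. a \<bullet> y) -` {-h..h} \<inter> p -` cball 0 \<rho>" by (auto simp: p_def abs_le_iff)
      moreover have "convex ((\<lambda>y. a \<bullet> y) -` {-h..h})"
        by (intro convex_linear_vimage) (auto intro!: linearI simp: inner_add_right)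
      moreover have "convex (p -` cball 0 \<rho>)" using linp by (intro convex_linear_vimage) auto
      ultimately show ?thesis by (simp add: convex_Int)
    qed
    moreover have "E \<subseteq> ?C" using E E\<rho> by auto
    ultimately show ?thesis unfolding hull by (intro hull_minimal)
  qed
  moreover have "?C \<subseteq> S"
  proof
    fix y assume y: "y \<in> ?C"
    define w where "w = y - (a \<bullet> y) *\<^sub>R a"
    \<comment> \<open>The radial direction of \<open>y\<close>; on the axis, where there is none,
      any unit vector orthogonal to \<open>a\<close> serves.\<close>
    obtain n where n: "norm n = 1" "a \<bullet> n = 0" "w = norm w *\<^sub>R n"
    proof (cases "w = 0")
      case True
      then show ?thesis using that[of "(1 / norm u) *\<^sub>R u"] u by simp
    next
      case False
      have "a \<bullet> w = 0" using aa by (simp add: w_def inner_diff_right)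
      then show ?thesis using that[of "(1 / norm w) *\<^sub>R w"] False by simp
    qed
    have nn: "n \<bullet> n = 1" using n by (simp add: norm_eq_1)
    have corner: "\<alpha> *\<^sub>R a + \<beta> *\<^sub>R n \<in> S" if "\<bar>\<alpha>\<bar> = h" "\<bar>\<beta>\<bar> = \<rho>" for \<alpha> \<beta>
    proof (rule circ)
      have "\<alpha>\<^sup>2 = h\<^sup>2" "\<beta>\<^sup>2 = \<rho>\<^sup>2" using that by (metis power2_abs)+
      then have "norm (\<alpha> *\<^sub>R a + \<beta> *\<^sub>R n) ^ 2 = r\<^sup>2"
        unfolding power2_norm_eq_inner
        using aa nn n \<rho>2 by (simp add: inner_add_left inner_add_right inner_commute power2_eq_square)
      then show "norm (\<alpha> *\<^sub>R a + \<beta> *\<^sub>R n) = r" by (rule power2_eq_imp_eq) (auto simp: r_def)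
      show "\<bar>a \<bullet> (\<alpha> *\<^sub>R a + \<beta> *\<^sub>R n)\<bar> = h" using aa n that by (simp add: inner_add_right)
    qed
    \<comment> \<open>In the plane of \<open>a\<close> and \<open>n\<close>, the cross-section is a
      rectangle with its corners on the two circles. Its horizontal sides are filled from the
      corners, and vertical segments between these sides reach \<open>y\<close>.\<close>
    have "\<alpha> *\<^sub>R a + norm w *\<^sub>R n \<in> S" if "\<bar>\<alpha>\<bar> = h" for \<alpha>
    proof (rule segment_memI[OF S(2)])
      show "\<alpha> *\<^sub>R a - \<rho> *\<^sub>R n \<in> S" using corner[OF that, of "- \<rho>"] \<rho> by simp
      show "\<alpha> *\<^sub>R a + \<rho> *\<^sub>R n \<in> S" using corner[OF that, of \<rho>] \<rho> by simp
      show "\<bar>norm w\<bar> \<le> \<rho>" using y by (simp add: w_def)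
    qed
    note edge = this
    have "norm w *\<^sub>R n + (a \<bullet> y) *\<^sub>R a \<in> S"
    proof (rule segment_memI[OF S(2)])
      show "norm w *\<^sub>R n - h *\<^sub>R a \<in> S" using edge[of "- h"] h by simp
      show "norm w *\<^sub>R n + h *\<^sub>R a \<in> S" using edge[of h] h by (simp add: add.commute)
      show "\<bar>a \<bullet> y\<bar> \<le> h" using y by simp
    qed
    also have "norm w *\<^sub>R n + (a \<bullet> y) *\<^sub>R a = y"
      by (subst n(3)[symmetric]) (simp add: w_def)
    finally show "y \<in> S" .
  qed
  ultimately show ?thesis using that[OF h \<rho>] by blast
qed

lemma orthogonally_transitive_classification:
  fixes S :: "(real^3) set"
  assumes S: "compact S" "convex S" "interior S \<noteq> {}"
    and tr: "\<And>x y. \<lbrakk>x extreme_point_of S; y extreme_point_of S\<rbrakk> \<Longrightarrow>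
      \<exists>f\<in>orthogonal_symmetries S. f x = y"
  obtains (finite) "finite {x. x extreme_point_of S}"
    | (ball) r where "0 < r" "S = cball 0 r"
    | (cylinder) a h \<rho> where "norm a = 1" "0 < h" "0 < \<rho>"
        "S = {y. \<bar>a \<bullet> y\<bar> \<le> h \<and> norm (y - (a \<bullet> y) *\<^sub>R a) \<le> \<rho>}"
proof (cases "finite {x. x extreme_point_of S}")
  case inf: False
  define E where "E = {x. x extreme_point_of S}"
  have hull: "S = convex hull E" unfolding E_def by (rule Krein_Milman_Minkowski[OF S(1,2)])
  have "infinite E" using inf by (simp add: E_def)
  then obtain x where x: "x \<in> E" by fastforce
  \<comment> \<open>The extreme points form one orbit, so infinitely many of them need infinitely
    many symmetries.\<close>
  have "E \<subseteq> (\<lambda>f. f x) ` orthogonal_symmetries S" using tr x by (force simp: E_def)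
  then have "infinite (orthogonal_symmetries S)" using \<open>infinite E\<close> finite_surj by blast
  then obtain a where a: "norm a = 1" "\<And>t. rotation_about a t \<in> orthogonal_symmetries S"
    using rotation_axis_of_infinite_symmetries[OF S(1)] by blast
  show ?thesis
  proof (cases "\<forall>f\<in>orthogonal_symmetries S. f a = a \<or> f a = - a")
    case True
    then have ax: "\<And>f. f \<in> orthogonal_symmetries S \<Longrightarrow> f a = a \<or> f a = - a" by blast
    show ?thesis
    proof (rule cylinder_of_rotation_axis[OF S a(1)])
      fix h \<rho>
      assume "0 < h" "0 < \<rho>" "S = {y. \<bar>a \<bullet> y\<bar> \<le> h \<and> norm (y - (a \<bullet> y) *\<^sub>R a) \<le> \<rho>}"
      then show ?thesis by (rule cylinder[OF a(1)])
    qed (use a(2) ax tr in auto)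
  next
    case False
    then obtain f where f: "f \<in> orthogonal_symmetries S" "f a \<noteq> a" "f a \<noteq> - a" by blast
    then have o: "orthogonal_transformation f" by (simp add: orthogonal_symmetries_def)
    define b where "b = f a"
    have b: "norm b = 1" using o a by (simp add: b_def orthogonal_transformation_norm)
    have rb: "rotation_about b t \<in> orthogonal_symmetries S" for t
      unfolding b_def using rotation_symmetries_conj[OF f(1) a(2)] .
    have "a \<times> b \<noteq> 0"
    proof
      assume "a \<times> b = 0"
      then have "(a \<bullet> b)\<^sup>2 = 1" using norm_cross_dot[of a b] a b by simp
      then have "a \<bullet> b = 1 \<or> a \<bullet> b = - 1" by (simp add: power2_eq_1_iff)
      moreover have "(b - a) \<bullet> (b - a) = 2 - 2 * (a \<bullet> b)" "(b + a) \<bullet> (b + a) = 2 + 2 * (a \<bullet> b)"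
        using a(1) b by (simp_all add: inner_diff_left inner_diff_right inner_add_left inner_add_right
            inner_commute norm_eq_1)
      ultimately have "b - a = 0 \<or> b + a = 0" by (metis inner_eq_zero_iff diff_self mult_minus_right mult.right_neutral add.right_inverse)
      then show False using f by (simp add: b_def eq_neg_iff_add_eq_0)
    qed
    define r where "r = norm x"
    have En: "norm y = r" if "y \<in> E" for y
      using tr[of x y] x that by (auto simp: E_def r_def orthogonal_symmetries_def orthogonal_transformation_norm)
    have "r \<noteq> 0"
    proof
      assume "r = 0"
      then have "E \<subseteq> {0}" using En by auto
      then show False using \<open>infinite E\<close> finite_subset by blast
    qed
    then have r: "0 < r" by (simp add: r_def)
    have xS: "x \<in> S" using x by (simp add: E_def extreme_point_of_def)
    have "sphere 0 r \<subseteq> S"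
      using sphere_subset_of_two_rotation_axes[OF a(1) b \<open>a \<times> b \<noteq> 0\<close> a(2) rb S(1) xS _ r]
      by (simp add: r_def)
    have "cball 0 r \<subseteq> S"
    proof
      fix y assume y: "y \<in> cball (0 :: real^3) r"
      obtain n where n: "norm n = 1" "y = norm y *\<^sub>R n"
      proof (cases "y = 0")
        case True
        then show ?thesis using that[of a] a by simp
      next
        case False
        then show ?thesis using that[of "(1 / norm y) *\<^sub>R y"] by simp
      qed
      \<comment> \<open>Each point of the ball lies on a diameter with both ends on the
        sphere.\<close>
      have "0 + norm y *\<^sub>R n \<in> S"
      proof (rule segment_memI[OF S(2)])
        show "0 - r *\<^sub>R n \<in> S" "0 + r *\<^sub>R n \<in> S"
          using n(1) r by (auto intro!: subsetD[OF \<open>sphere 0 r \<subseteq> S\<close>])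
        show "\<bar>norm y\<bar> \<le> r" using y by simp
      qed
      then show "y \<in> S" by (simp flip: n(2))
    qed
    moreover have "S \<subseteq> cball 0 r"
      unfolding hull using En by (intro hull_minimal) auto
    ultimately show ?thesis using ball[OF r] by blast
  qed
qed (use finite in blast)

section \<open>The three models\<close>

text \<open>Only an input abbreviation, so that facts about it match the set written out in the
  theorem.\<close>

abbreviation (input) standard_cylinder :: "(real^3) set" where
  "standard_cylinder \<equiv> {p. (p $ 1)\<^sup>2 + (p $ 2)\<^sup>2 \<le> 1 \<and> 0 \<le> p $ 3 \<and> p $ 3 \<le> 1}"

text \<open>A point strictly inside a disc, or strictly between the bases, is the midpoint of a
  short segment parallel to the first, respectively third, coordinate axis.\<close>

lemma extreme_point_standard_cylinder:
  assumes "p extreme_point_of standard_cylinder"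
  shows "(p $ 1)\<^sup>2 + (p $ 2)\<^sup>2 = 1" "p $ 3 = 0 \<or> p $ 3 = 1"
proof -
  have p: "(p $ 1)\<^sup>2 + (p $ 2)\<^sup>2 \<le> 1" "0 \<le> p $ 3" "p $ 3 \<le> 1"
    using assms by (auto simp: extreme_point_of_def)
  have no_segment: False
    if "p - v \<in> standard_cylinder" "p + v \<in> standard_cylinder" "v \<noteq> 0" for v
  proof -
    have "p - v \<noteq> p + v"
    proof
      assume "p - v = p + v"
      then have "2 *\<^sub>R v = 0" by (simp add: scaleR_2 algebra_simps)
      then show False using that(3) by simp
    qed
    moreover have "midpoint (p - v) (p + v) = p" by (simp add: midpoint_def scaleR_2[symmetric])
    ultimately have "p \<in> open_segment (p - v) (p + v)" by (metis midpoint_in_open_segment)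
    then show False using assms that by (auto simp: extreme_point_of_def)
  qed
  show "(p $ 1)\<^sup>2 + (p $ 2)\<^sup>2 = 1"
  proof (rule ccontr)
    define s where "s = (p $ 1)\<^sup>2 + (p $ 2)\<^sup>2"
    \<comment> \<open>A shift of the first coordinate by \<open>\<delta>\<close> raises its square
      by at most \<open>2 * \<delta> + \<delta> * \<delta>\<close>, hence by at most
      \<open>3 * \<delta>\<close>, exactly the slack available.\<close>
    define \<delta> where "\<delta> = (1 - s) / 3"
    assume "(p $ 1)\<^sup>2 + (p $ 2)\<^sup>2 \<noteq> 1"
    then have "0 \<le> s" "s < 1" using p(1) by (auto simp: s_def)
    then have "0 < \<delta>" "\<delta> \<le> 1" "s + 3 * \<delta> = 1" by (simp_all add: \<delta>_def field_simps)
    then have \<delta>: "0 < \<delta>" "\<delta> \<le> 1" "(p $ 1)\<^sup>2 + (p $ 2)\<^sup>2 + 3 * \<delta> = 1"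
      by (simp_all add: s_def)
    have "(p $ 1)\<^sup>2 \<le> 1" using p(1) zero_le_power2[of "p $ 2"] by linarith
    then have p1: "\<bar>p $ 1\<bar> \<le> 1" by (simp add: abs_square_le_1)
    have "\<delta> * \<delta> \<le> \<delta> * 1" using \<delta> by (intro mult_left_mono) auto
    moreover have "\<bar>p $ 1\<bar> * \<delta> \<le> 1 * \<delta>" using p1 \<delta> by (intro mult_right_mono) auto
    moreover have "\<bar>(p $ 1) * \<delta>\<bar> = \<bar>p $ 1\<bar> * \<delta>" using \<delta> by (simp add: abs_mult)
    ultimately have "2 * (p $ 1 * \<delta>) + \<delta> * \<delta> \<le> 3 * \<delta>" "- (2 * (p $ 1 * \<delta>)) + \<delta> * \<delta> \<le> 3 * \<delta>"
      by linarith+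
    then have "(p $ 1 + \<delta>)\<^sup>2 + (p $ 2)\<^sup>2 \<le> 1" "(p $ 1 - \<delta>)\<^sup>2 + (p $ 2)\<^sup>2 \<le> 1"
      using \<delta>(3) by (simp_all add: power2_eq_square algebra_simps)
    moreover have "axis 1 \<delta> \<noteq> (0 :: real^3)" using \<delta>(1) by (simp add: axis_eq_0_iff)
    ultimately show False
      using p by (intro no_segment[of "axis 1 \<delta>"]) (simp_all add: axis_def)
  qed
  show "p $ 3 = 0 \<or> p $ 3 = 1"
  proof (rule ccontr)
    define \<delta> where "\<delta> = min (p $ 3) (1 - p $ 3)"
    assume "\<not> (p $ 3 = 0 \<or> p $ 3 = 1)"
    then have \<delta>: "0 < \<delta>" "\<delta> \<le> p $ 3" "\<delta> \<le> 1 - p $ 3" using p by (auto simp: \<delta>_def)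
    then have "axis 3 \<delta> \<noteq> (0 :: real^3)" by (simp add: axis_eq_0_iff)
    then show False
      using p \<delta> by (intro no_segment[of "axis 3 \<delta>"]) (simp_all add: axis_def)
  qed
qed

text \<open>Rotating the discs matches the horizontal parts of \<open>p\<close> and
  \<open>q\<close>; exchanging the two bases when needed matches their heights.\<close>

lemma affinely_transitive_standard_cylinder: "affinely_transitive standard_cylinder"
  unfolding affinely_transitive_def
proof (intro allI impI)
  fix p q assume pq: "p extreme_point_of standard_cylinder" "q extreme_point_of standard_cylinder"
  note p = extreme_point_standard_cylinder[OF pq(1)] and q = extreme_point_standard_cylinder[OF pq(2)]
  \<comment> \<open>Identifying the horizontal plane with the complex numbers, the rotation is
    multiplication by \<open>q / p\<close>.\<close>
  define c s where "c = q $ 1 * p $ 1 + q $ 2 * p $ 2" and "s = q $ 2 * p $ 1 - q $ 1 * p $ 2"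
  define z where "z t = (if p $ 3 = q $ 3 then t else 1 - t)" for t :: real
  have "c\<^sup>2 + s\<^sup>2 = ((p $ 1)\<^sup>2 + (p $ 2)\<^sup>2) * ((q $ 1)\<^sup>2 + (q $ 2)\<^sup>2)"
    unfolding c_def s_def by algebra
  then have cs: "c\<^sup>2 + s\<^sup>2 = 1" using p q by simp
  \<comment> \<open>With \<open>\<sigma>\<close> as a parameter, \<open>rot (- s)\<close> serves as
    the inverse of \<open>rot s\<close>, because the height map \<open>z\<close> is an
    involution.\<close>
  define rot :: "real \<Rightarrow> real^3 \<Rightarrow> real^3"
    where "rot \<sigma> x = vector [c * x $ 1 - \<sigma> * x $ 2, \<sigma> * x $ 1 + c * x $ 2, z (x $ 3)]" for \<sigma> x
  have in_cyl: "rot \<sigma> x \<in> standard_cylinder" if "c\<^sup>2 + \<sigma>\<^sup>2 = 1" "x \<in> standard_cylinder" for \<sigma> x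
  proof -
    have "(c * x $ 1 - \<sigma> * x $ 2)\<^sup>2 + (\<sigma> * x $ 1 + c * x $ 2)\<^sup>2
        = (c\<^sup>2 + \<sigma>\<^sup>2) * ((x $ 1)\<^sup>2 + (x $ 2)\<^sup>2)"
      by algebra
    then show ?thesis using that by (auto simp: rot_def z_def)
  qed
  have inv: "rot (- \<sigma>) (rot \<sigma> x) = x" if "c\<^sup>2 + \<sigma>\<^sup>2 = 1" for \<sigma> x
  proof -
    have "c * (c * x $ 1 - \<sigma> * x $ 2) + \<sigma> * (\<sigma> * x $ 1 + c * x $ 2) = (c\<^sup>2 + \<sigma>\<^sup>2) * x $ 1"
      "- \<sigma> * (c * x $ 1 - \<sigma> * x $ 2) + c * (\<sigma> * x $ 1 + c * x $ 2) = (c\<^sup>2 + \<sigma>\<^sup>2) * x $ 2"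
      by algebra+
    then show ?thesis using that by (simp add: rot_def vec_eq_iff forall_3 z_def)
  qed
  have "bij_betw (rot s) standard_cylinder standard_cylinder"
    using in_cyl[OF cs] in_cyl[of "- s"] inv[OF cs] inv[of "- s"] cs
    by (intro bij_betwI[of _ _ _ "rot (- s)"]) auto
  moreover have "affine_map_on standard_cylinder (rot s)"
    unfolding affine_map_on_def
  proof (intro ballI allI impI)
    fix x y :: "real^3" and u v :: real
    assume "u + v = 1"
    then have v: "v = 1 - u" by simp
    show "rot s (u *\<^sub>R x + v *\<^sub>R y) = u *\<^sub>R rot s x + v *\<^sub>R rot s y"
      by (simp add: rot_def vec_eq_iff forall_3 z_def v algebra_simps)
  qed
  moreover have "rot s p = q"
  proof -
    have "c * p $ 1 - s * p $ 2 = q $ 1 * ((p $ 1)\<^sup>2 + (p $ 2)\<^sup>2)"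
      "s * p $ 1 + c * p $ 2 = q $ 2 * ((p $ 1)\<^sup>2 + (p $ 2)\<^sup>2)"
      unfolding c_def s_def by algebra+
    moreover have "z (p $ 3) = q $ 3" using p(2) q(2) by (auto simp: z_def)
    ultimately show ?thesis using p(1) by (simp add: rot_def vec_eq_iff forall_3)
  qed
  ultimately show "\<exists>f. bij_betw f standard_cylinder standard_cylinder \<and>
      affine_map_on standard_cylinder f \<and> f p = q" by blast
qed

lemma affinely_transitive_cball: "affinely_transitive (cball (0 :: real^'n) 1)"
  unfolding affinely_transitive_def
proof (intro allI impI)
  fix p q :: "real^'n"
  assume "p extreme_point_of cball 0 1" "q extreme_point_of cball 0 1"
  then have "norm p = 1" "norm q = 1"
    using extreme_point_not_in_interior[of _ "cball (0 :: real^'n) 1"]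
    by (force simp: extreme_point_of_def)+
  then obtain f where f: "orthogonal_transformation f" "f p = q"
    by (rule orthogonal_transformation_exists_1)
  have "bij_betw f (cball 0 1) (cball 0 1)"
    using image_orthogonal_transformation_cball[OF f(1), of 0 1] f(1)
      linear_0[OF orthogonal_transformation_linear[OF f(1)]]
    by (auto simp: bij_betw_def intro: inj_on_subset[OF orthogonal_transformation_inj])
  moreover have "affine_map_on (cball 0 1) f"
    using affine_map_on_linear_translation[OF orthogonal_transformation_linear[OF f(1)], of _ 0] by simp
  ultimately show "\<exists>f. bij_betw f (cball 0 1) (cball 0 1) \<and> affine_map_on (cball 0 1) f \<and> f p = q"
    using f(2) by blast
qed

text \<open>An orthogonal map turns \<open>a\<close> into the third basis vector. Dividing by
  \<open>\<rho>\<close> normalizes the radius, and the heights from \<open>- h\<close> to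
  \<open>h\<close> are shifted and scaled to the unit interval.\<close>

lemma cylinder_affine_isomorphic:
  fixes a :: "real^3"
  assumes a: "norm a = 1" and h: "0 < h" and \<rho>: "0 < \<rho>"
  shows "affine_isomorphic {y. \<bar>a \<bullet> y\<bar> \<le> h \<and> norm (y - (a \<bullet> y) *\<^sub>R a) \<le> \<rho>} standard_cylinder"
    (is "affine_isomorphic ?C _")
proof -
  have "norm (axis 3 1 :: real^3) = 1" by simp
  with a obtain f :: "real^3 \<Rightarrow> real^3" where f: "orthogonal_transformation f" "f a = axis 3 1"
    by (rule orthogonal_transformation_exists_1) (rule that)
  have lin: "linear f" using f(1) by (rule orthogonal_transformation_linear)
  have ay: "a \<bullet> y = f y $ 3" for y
  proof -
    have "a \<bullet> y = f a \<bullet> f y" using f(1) by (simp add: orthogonal_transformation_def)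
    then show ?thesis by (simp add: f(2) inner_axis inner_commute)
  qed
  have perp: "norm (y - (a \<bullet> y) *\<^sub>R a) \<le> \<rho> \<longleftrightarrow> (f y $ 1)\<^sup>2 + (f y $ 2)\<^sup>2 \<le> \<rho>\<^sup>2" for y
  proof -
    have "(norm (y - (a \<bullet> y) *\<^sub>R a))\<^sup>2 = (norm (f (y - (a \<bullet> y) *\<^sub>R a)))\<^sup>2"
      using f(1) by (simp add: orthogonal_transformation_norm)
    also have "f (y - (a \<bullet> y) *\<^sub>R a) = f y - (f y $ 3) *\<^sub>R axis 3 1"
      by (simp add: linear_diff[OF lin] linear_cmul[OF lin] f(2) ay)
    also have "(norm \<dots>)\<^sup>2 = (f y $ 1)\<^sup>2 + (f y $ 2)\<^sup>2"
      unfolding power2_norm_eq_inner by (simp add: inner_vec_def sum_3 axis_def power2_eq_square)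
    finally have "(norm (y - (a \<bullet> y) *\<^sub>R a))\<^sup>2 = (f y $ 1)\<^sup>2 + (f y $ 2)\<^sup>2" .
    then show ?thesis using \<rho> by (metis norm_ge_zero less_imp_le power2_le_iff_abs_le abs_norm_cancel)
  qed
  define g :: "real^3 \<Rightarrow> real^3"
    where "g y = vector [f y $ 1 / \<rho>, f y $ 2 / \<rho>, (f y $ 3 + h) / (2 * h)]" for y
  define k where "k z = inv_into UNIV f (vector [\<rho> * z $ 1, \<rho> * z $ 2, 2 * h * z $ 3 - h])" for z :: "real^3"
  have fk: "f (k z) = vector [\<rho> * z $ 1, \<rho> * z $ 2, 2 * h * z $ 3 - h]" for z
    using orthogonal_transformation_surj[OF f(1)] by (simp add: k_def surj_f_inv_f)
  have "bij_betw g ?C standard_cylinder"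
  proof (rule bij_betwI[where g = k])
    show "g \<in> ?C \<rightarrow> standard_cylinder"
    proof
      fix y assume y: "y \<in> ?C"
      then have "(f y $ 1 / \<rho>)\<^sup>2 + (f y $ 2 / \<rho>)\<^sup>2 \<le> 1"
        using perp[of y] \<rho> by (simp add: power_divide pos_divide_le_eq flip: add_divide_distrib)
      then show "g y \<in> standard_cylinder" using y h by (simp add: g_def ay abs_le_iff field_simps)
    qed
    show "k \<in> standard_cylinder \<rightarrow> ?C"
    proof
      fix z assume z: "z \<in> standard_cylinder"
      have "(\<rho> * z $ 1)\<^sup>2 + (\<rho> * z $ 2)\<^sup>2 = \<rho>\<^sup>2 * ((z $ 1)\<^sup>2 + (z $ 2)\<^sup>2)" by algebra
      also have "\<dots> \<le> \<rho>\<^sup>2 * 1" using z by (intro mult_left_mono) auto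
      finally have "norm (k z - (a \<bullet> k z) *\<^sub>R a) \<le> \<rho>" by (simp add: perp fk)
      moreover have "h * z $ 3 \<le> h * 1" "0 \<le> h * z $ 3" using z h by (auto intro!: mult_left_mono)
      ultimately show "k z \<in> ?C" by (simp add: ay fk abs_le_iff)
    qed
    show "k (g y) = y" for y
    proof -
      have "f (k (g y)) = f y" using h \<rho> by (simp add: fk g_def vec_eq_iff forall_3)
      then show ?thesis using orthogonal_transformation_inj[OF f(1)] by (rule injD[rotated])
    qed
    show "g (k z) = z" for z using h \<rho> by (simp add: fk g_def vec_eq_iff forall_3)
  qed
  moreover have "affine_map_on ?C g"
    unfolding affine_map_on_def
  proof (intro ballI allI impI)
    fix x y :: "real^3" and u v :: real
    assume "u + v = 1"
    then have v: "v = 1 - u" by simp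
    have fuv: "f (u *\<^sub>R x + v *\<^sub>R y) = u *\<^sub>R f x + v *\<^sub>R f y"
      by (simp add: linear_add[OF lin] linear_cmul[OF lin])
    show "g (u *\<^sub>R x + v *\<^sub>R y) = u *\<^sub>R g x + v *\<^sub>R g y"
      unfolding g_def fuv using h \<rho> by (simp add: vec_eq_iff forall_3 v field_simps)
  qed
  ultimately show ?thesis unfolding affine_isomorphic_def by blast
qed

section \<open>Classification\<close>

text \<open>The model is the image of \<open>S\<close> under \<open>x \<mapsto> N (x - c)\<close>:
  each automorphism of \<open>S\<close> extends to an invertible affine map of the space, which this
  change of coordinates conjugates to an orthogonal map.\<close>

lemma affinely_transitive_orthogonal_model:
  fixes S :: "(real^3) set"
  assumes S: "compact S" "convex S" "interior S \<noteq> {}" and tr: "affinely_transitive S"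
  obtains T :: "(real^3) set" where "compact T" "convex T" "interior T \<noteq> {}" "affine_isomorphic S T"
    "\<And>x y. \<lbrakk>x extreme_point_of T; y extreme_point_of T\<rbrakk> \<Longrightarrow> \<exists>f\<in>orthogonal_symmetries T. f x = y"
proof -
  obtain c and N :: "real^3 \<Rightarrow> real^3" where N: "linear N" "inj N"
    and orth: "\<And>L b. \<lbrakk>linear L; (\<lambda>x. L x + b) ` S = S; inj L\<rbrakk> \<Longrightarrow>
       \<exists>f. orthogonal_transformation f \<and> (\<forall>x. N (L x + b - c) = f (N (x - c)))"
    by (rule affine_automorphisms_orthogonalizable[OF S(1,3)]) (rule that)
  define n where "n x = N (x - c)" for x
  have n: "n x = N x + N (- c)" for x
    by (simp add: n_def linear_diff[OF N(1)] linear_neg[OF N(1)])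
  define T where "T = n ` S"
  have TN: "T = N ` (\<lambda>x. x - c) ` S" by (auto simp: T_def n_def)
  have injn: "inj n" using N(2) by (auto simp: inj_on_def n)
  have aff: "affine_map_on S n"
    using affine_map_on_linear_translation[OF N(1), of S "N (- c)"] by (simp add: n[abs_def])
  have "compact T" unfolding TN using S(1) N(1)
    by (intro compact_continuous_image compact_translation_subtract linear_continuous_on)
      (simp_all add: linear_conv_bounded_linear)
  moreover have "convex T" unfolding TN using S(2) N(1)
    by (intro convex_linear_image convex_translation_subtract)
  moreover have "interior T \<noteq> {}"
    unfolding TN interior_injective_linear_image[OF N] interior_translation_subtract using S(3) by simp
  moreover have "affine_isomorphic S T"
    using aff injn unfolding affine_isomorphic_def T_def
    by (auto simp: bij_betw_def intro: inj_on_subset)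
  moreover have "\<exists>f\<in>orthogonal_symmetries T. f x = y"
    if xy: "x extreme_point_of T" "y extreme_point_of T" for x y
  proof -
    have injS: "inj_on n S" using injn by (rule inj_on_subset) simp
    obtain x' where x': "x' extreme_point_of S" "n x' = x"
      using extreme_point_of_injective_affine_image[OF aff injS S(2) xy(1)[unfolded T_def]] .
    obtain y' where y': "y' extreme_point_of S" "n y' = y"
      using extreme_point_of_injective_affine_image[OF aff injS S(2) xy(2)[unfolded T_def]] .
    obtain g where g: "bij_betw g S S" "affine_map_on S g" "g x' = y'"
      using tr x' y' by (auto simp: affinely_transitive_def)
    obtain p where p: "p \<in> interior S" using S(3) by blast
    obtain L b where L: "linear L" "\<And>x. x \<in> S \<Longrightarrow> g x = L x + b"
      by (rule affine_map_on_extend[OF g(2) p]) (rule that)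
    have img: "(\<lambda>x. L x + b) ` S = S"
      using g(1) L(2) by (simp add: bij_betw_def cong: image_cong)
    \<comment> \<open>Along a kernel direction of \<open>L\<close> the automorphism would be
      constant near the interior point \<open>p\<close>, contradicting its injectivity.\<close>
    have "inj L"
    proof -
      obtain e where e: "0 < e" "ball p e \<subseteq> S" using p by (auto simp: mem_interior)
      show ?thesis
        unfolding linear_injective_0[OF L(1)]
      proof (intro allI impI, rule ccontr)
        fix v assume v: "L v = 0" "v \<noteq> 0"
        define w where "w = (e / (2 * norm v)) *\<^sub>R v"
        have pw: "p + w \<in> S" "p \<in> S"
          using e v by (auto intro!: subsetD[OF e(2)] simp: w_def dist_norm)
        then have "g (p + w) = g p"
          using L v by (simp add: w_def linear_add linear_cmul)
        then have "p + w = p" using g(1) pw by (metis bij_betw_imp_inj_on inj_onD)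
        then show False using e v by (simp add: w_def)
      qed
    qed
    obtain f where f: "orthogonal_transformation f" "\<And>x. n (L x + b) = f (n x)"
      using orth[OF L(1) img \<open>inj L\<close>] unfolding n_def by auto
    have "f ` T = n ` (\<lambda>x. L x + b) ` S" by (simp add: T_def image_image f(2))
    then have "f ` T = T" by (simp add: img T_def)
    moreover have "f x = y"
      using f(2)[of x'] L(2)[of x'] g(3) x' y' by (simp add: extreme_point_of_def)
    ultimately show ?thesis using f(1) by (auto simp: orthogonal_symmetries_def)
  qed
  ultimately show ?thesis using that by blast
qed

text \<open>Vertex transitivity asks for isometries, which the original body need not have; the
  normalized body has them, since its symmetries are orthogonal.\<close>

lemma polytope_of_finite_extreme_points:
  fixes S :: "(real^3) set"
  assumes S: "compact S" "convex S" "interior S \<noteq> {}" and fin: "finite {x. x extreme_point_of S}"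
    and tr: "\<And>x y. \<lbrakk>x extreme_point_of S; y extreme_point_of S\<rbrakk> \<Longrightarrow>
      \<exists>f\<in>orthogonal_symmetries S. f x = y"
  shows "polytope S" "aff_dim S = 3" "vertex_transitive S"
proof -
  show "polytope S"
    using Krein_Milman_Minkowski[OF S(1,2)] fin unfolding polytope_def by blast
  show "aff_dim S = 3"
    using aff_dim_nonempty_interior[OF S(3)] by simp
  show "vertex_transitive S"
    unfolding vertex_transitive_iff[OF S(2)]
  proof (intro allI impI)
    fix x y assume "x extreme_point_of S" "y extreme_point_of S"
    then obtain f where f: "orthogonal_transformation f" "f ` S = S" "f x = y"
      using tr[of x y] by (auto simp: orthogonal_symmetries_def)
    have lin: "linear f" using f(1) by (rule orthogonal_transformation_linear)
    have "dist (f u) (f v) = dist u v" for u v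
      using orthogonal_transformation_norm[OF f(1), of "u - v"] by (simp add: dist_norm linear_diff[OF lin])
    moreover have "affine_map_on UNIV f"
      using affine_map_on_linear_translation[OF lin, of UNIV 0] by simp
    ultimately show "\<exists>f. bij f \<and> affine_map_on UNIV f \<and> (\<forall>x y. dist (f x) (f y) = dist x y) \<and>
        f ` S = S \<and> f x = y"
      using f orthogonal_transformation_bij[OF f(1)] by blast
  qed
qed

theorem theorem2:
  fixes S :: "'a::euclidean_space set"
  assumes "compact S" and "convex S" and "aff_dim S = 3"
  shows "acts_transitively_on (affine_automorphism_group S) {x. x extreme_point_of S} \<longleftrightarrow>
    (\<exists>P :: (real ^ 3) set. polytope P \<and> aff_dim P = 3 \<and> vertex_transitive P \<and>
        affine_isomorphic S P) \<or>
    affine_isomorphic S {p :: real ^ 3. (p $ 1)\<^sup>2 + (p $ 2)\<^sup>2 \<le> 1 \<and> 0 \<le> p $ 3 \<and> p $ 3 \<le> 1} \<or>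
    affine_isomorphic S (cball (0 :: real ^ 3) 1)"
    (is "?lhs \<longleftrightarrow> ?polytope \<or> ?cylinder \<or> ?ball")
proof -
  have lhs: "?lhs \<longleftrightarrow> affinely_transitive S"
    unfolding affinely_transitive_def by (rule affine_automorphisms_transitive_iff[OF assms(2)])
  have "?polytope \<or> ?cylinder \<or> ?ball" if tr: "affinely_transitive S"
  proof -
    obtain T :: "(real^3) set" where T: "compact T" "convex T" "interior T \<noteq> {}" "affine_isomorphic S T"
      using affine_isomorphic_full_dimensional[OF assms(1,2), where 'b = "real^3"] assms(3) by auto
    have "affinely_transitive T"
      using affinely_transitive_isomorphic[OF affine_isomorphic_sym[OF T(4) assms(2)] T(2) tr] .
    from affinely_transitive_orthogonal_model[OF T(1-3) this] obtain U :: "(real^3) set"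
      where U: "compact U" "convex U" "interior U \<noteq> {}" and TU: "affine_isomorphic T U"
        and orth: "\<And>x y. \<lbrakk>x extreme_point_of U; y extreme_point_of U\<rbrakk> \<Longrightarrow>
          \<exists>f\<in>orthogonal_symmetries U. f x = y"
      by blast
    have SU: "affine_isomorphic S U" using T(4) TU by (rule affine_isomorphic_trans)
    show ?thesis
    proof (rule orthogonally_transitive_classification[OF U orth])
      assume "finite {x. x extreme_point_of U}"
      from polytope_of_finite_extreme_points[OF U this orth] show ?thesis using SU by blast
    next
      fix r assume ball: "0 < r" "U = cball 0 r"
      have "affine_isomorphic (cball (0 :: real^3) r) ((\<lambda>x. (1 / r) *\<^sub>R x + 0) ` cball (0 :: real^3) r)"
        using ball(1) affine_isomorphic_linear_image[OF linear_scaleR[of "1 / r"], of "cball (0 :: real^3) r" 0]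
        by (simp add: inj_on_def)
      also have "(\<lambda>x. (1 / r) *\<^sub>R x + 0) ` cball (0 :: real^3) r = cball 0 1"
        using ball(1) cball_scale[of "1 / r" "0 :: real^3" r] by simp
      finally show ?thesis using SU ball(2) affine_isomorphic_trans by blast
    next
      fix a h \<rho>
      assume cylinder: "norm a = 1" "0 < h" "0 < \<rho>"
        "U = {y. \<bar>a \<bullet> y\<bar> \<le> h \<and> norm (y - (a \<bullet> y) *\<^sub>R a) \<le> \<rho>}"
      show ?thesis
        using affine_isomorphic_trans[OF SU[unfolded cylinder(4)] cylinder_affine_isomorphic[OF cylinder(1-3)]]
        by blast
    qed
  qed
  \<comment> \<open>For the converse, transitivity is checked on the models and pulled back to
    \<open>S\<close>.\<close>
  moreover have "affinely_transitive S" if "?polytope \<or> ?cylinder \<or> ?ball"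
    using that
  proof (elim disjE exE conjE)
    fix P :: "(real^3) set"
    assume "polytope P" "vertex_transitive P" "affine_isomorphic S P"
    then show ?thesis
      using affinely_transitive_isomorphic[OF _ assms(2)] affinely_transitive_vertex_transitive
        polytope_imp_convex by blast
  next
    assume ?cylinder
    then show ?thesis
      using assms(2) affinely_transitive_standard_cylinder by (rule affinely_transitive_isomorphic)
  next
    assume ?ball
    then show ?thesis
      using assms(2) affinely_transitive_cball by (rule affinely_transitive_isomorphic)
  qed
  ultimately show ?thesis using lhs by blast
qed

end
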